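(* Let $\varepsilon>0$ and let $P,Q$ be Borel probability measures on $\mathbb{R}^d$ that do not charge the boundary of any convex subset of $\mathbb{R}^d$, whose topological supports $\Omega:=\operatorname{spt}P$ and $\Omega':=\operatorname{spt}Q$ are compact, and such that $\Omega'$ is connected. Let $f_0:\Omega\to\mathbb{R}$ and $g_0:\Omega'\to\mathbb{R}$ be Lipschitz continuous with $\int f_0\,dP=\int g_0\,dQ$, and let $\eta\in(0,\varepsilon)$. Let $(f_n,g_n)_{n\ge 0}$ be the gradient descent iterates with step size $\eta$ started at $(f_0,g_0)$, and let $(f_*,g_* )\in L^2_\oplus$ be the potentials of the quadratically regularized optimal transport problem with marginals $P,Q$ and regularization parameter $\varepsilon$. Then there exist constants $\delta_*\in(0,1)$ and $n_0\in\mathbb{N}$ such that $$\|(f_n,g_n)-(f_*,g_* )\|_{L^2_\oplus}\le \delta_*^n\qquad\text{for all } n\ge n_0 .$$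
   Context: $L^2_\oplus:=\{(f,g)\in L^2(P)\times L^2(Q):\int f\,dP=\int g\,dQ\}$, a Hilbert space with inner product $\langle (f,g),(u,v)\rangle_{L^2_\oplus}=\langle f,u\rangle_{L^2(P)}+\langle g,v\rangle_{L^2(Q)}$ and the induced norm $\|\cdot\|_{L^2_\oplus}$. Write $(t)_+=\max\{t,0\}$. The quadratically regularized optimal transport problem is $\inf_{\pi\in\Pi(P,Q)}\int\frac12\|x-y\|^2d\pi(x,y)+\frac{\varepsilon}{2}\big\|\frac{d\pi}{d(P\otimes Q)}\big\|^2_{L^2(P\otimes Q)}$, where $\Pi(P,Q)$ is the set of couplings of $P$ and $Q$ and the last term is $+\infty$ if $\pi\not\ll P\otimes Q$. It has a unique solution $\pi_*$. The potentials are the unique pair $(f_*,g_* )\in L^2_\oplus$ with $\frac{d\pi_*}{d(P\otimes Q)}(x,y)=\frac1\varepsilon\big(f_*(x)+g_*(y)-\frac12\|x-y\|^2\big)_+$; equivalently, the unique maximizer over $L^2_\oplus$ of the dual objective $$\Gamma(f,g)=\int f\,dP+\int g\,dQ-\frac1{2\varepsilon}\int\big(f(x)+g(y)-\tfrac12\|x-y\|^2\big)_+^2\,d(P\otimes Q)(x,y).$$ The gradient descent iterates with step size $\eta$ are defined for $n\ge0$ by $$f_{n+1}(x)=f_n(x)+\eta\Big(1-\frac1\varepsilon\int\big(f_n(x)+g_n(y)-\tfrac12\|x-y\|^2\big)_+dQ(y)\Big),\quad x\in\Omega,$$ $$g_{n+1}(y)=g_n(y)+\eta\Big(1-\frac1\varepsilon\int\big(f_n(x)+g_n(y)-\tfrac12\|x-y\|^2\big)_+dP(x)\Big),\quad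 y\in\Omega',$$ where both updates use $(f_n,g_n)$. *)

theory Defs
  imports "HOL-Probability.Probability"
begin

definition topological_support :: "'a::topological_space measure \<Rightarrow> 'a set" where
  "topological_support M = {x. \<forall>U. open U \<and> x \<in> U \<longrightarrow> 0 < emeasure M U}"

text \<open>The frontier is closed, so the measure below is that of a Borel set even if \<open>C\<close> is not Borel.\<close>
definition charges_no_convex_boundary :: "'a::euclidean_space measure \<Rightarrow> bool" where
  "charges_no_convex_boundary M \<longleftrightarrow> (\<forall>C. convex C \<longrightarrow> emeasure M (frontier C) = 0)"

definition square_integrable :: "'a measure \<Rightarrow> ('a \<Rightarrow> real) \<Rightarrow> bool" where
  "square_integrable M f \<longleftrightarrow> f \<in> borel_measurable M \<and> integrable M (\<lambda>x. (f x)\<^sup>2)"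

text \<open>Elements of \<open>L\<^sup>2\<close> are represented by functions rather than by classes of a.e. equal functions.\<close>
definition L2sum :: "'a measure \<Rightarrow> 'a measure \<Rightarrow> (('a \<Rightarrow> real) \<times> ('a \<Rightarrow> real)) set" where
  "L2sum P Q = {(f, g). square_integrable P f \<and> square_integrable Q g \<and>
      (\<integral>x. f x \<partial>P) = (\<integral>y. g y \<partial>Q)}"

definition L2sum_inner ::
  "'a measure \<Rightarrow> 'a measure \<Rightarrow> ('a \<Rightarrow> real) \<times> ('a \<Rightarrow> real) \<Rightarrow> ('a \<Rightarrow> real) \<times> ('a \<Rightarrow> real) \<Rightarrow> real" where
  "L2sum_inner P Q p q =
     (\<integral>x. fst p x * fst q x \<partial>P) + (\<integral>y. snd p y * snd q y \<partial>Q)"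

definition L2sum_norm ::
  "'a measure \<Rightarrow> 'a measure \<Rightarrow> ('a \<Rightarrow> real) \<times> ('a \<Rightarrow> real) \<Rightarrow> real" where
  "L2sum_norm P Q p = sqrt (L2sum_inner P Q p p)"

definition couplings ::
  "'a::euclidean_space measure \<Rightarrow> 'a measure \<Rightarrow> ('a \<times> 'a) measure set" where
  "couplings P Q = {\<pi>. prob_space \<pi> \<and> sets \<pi> = sets (P \<Otimes>\<^sub>M Q) \<and>
      distr \<pi> borel fst = P \<and> distr \<pi> borel snd = Q}"

definition qot_cost ::
  "real \<Rightarrow> 'a::euclidean_space measure \<Rightarrow> 'a measure \<Rightarrow> ('a \<times> 'a) measure \<Rightarrow> ennreal" where
  "qot_cost \<epsilon> P Q \<pi> =
     (\<integral>\<^sup>+(x, y). ennreal ((norm (x - y))\<^sup>2 / 2) \<partial>\<pi>) +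
     (if absolutely_continuous (P \<Otimes>\<^sub>M Q) \<pi>
      then ennreal (\<epsilon> / 2) * (\<integral>\<^sup>+z. (RN_deriv (P \<Otimes>\<^sub>M Q) \<pi> z)\<^sup>2 \<partial>(P \<Otimes>\<^sub>M Q))
      else \<infinity>)"

definition qot_optimal ::
  "real \<Rightarrow> 'a::euclidean_space measure \<Rightarrow> 'a measure \<Rightarrow> ('a \<times> 'a) measure \<Rightarrow> bool" where
  "qot_optimal \<epsilon> P Q \<pi> \<longleftrightarrow>
     \<pi> \<in> couplings P Q \<and> (\<forall>\<pi>'\<in>couplings P Q. qot_cost \<epsilon> P Q \<pi> \<le> qot_cost \<epsilon> P Q \<pi>')"

definition qot_excess ::
  "('a::euclidean_space \<Rightarrow> real) \<Rightarrow> ('a \<Rightarrow> real) \<Rightarrow> 'a \<Rightarrow> 'a \<Rightarrow> real" where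
  "qot_excess f g x y = max 0 (f x + g y - (norm (x - y))\<^sup>2 / 2)"

definition qot_potentials ::
  "real \<Rightarrow> 'a::euclidean_space measure \<Rightarrow> 'a measure \<Rightarrow> ('a \<Rightarrow> real) \<times> ('a \<Rightarrow> real) \<Rightarrow> bool" where
  "qot_potentials \<epsilon> P Q p \<longleftrightarrow> p \<in> L2sum P Q \<and>
     (\<exists>\<pi>. qot_optimal \<epsilon> P Q \<pi> \<and> absolutely_continuous (P \<Otimes>\<^sub>M Q) \<pi> \<and>
       (AE (x, y) in P \<Otimes>\<^sub>M Q.
          RN_deriv (P \<Otimes>\<^sub>M Q) \<pi> (x, y) = ennreal (1 / \<epsilon> * qot_excess (fst p) (snd p) x y)))"

text \<open>
  The iterates live on the supports of \<open>P\<close> and \<open>Q\<close>. They are extended by zero, so that they are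
  Borel functions on the whole space (the supports being closed) whatever junk values
  the total functions \<open>f0\<close>, \<open>g0\<close> take off the supports; an integral of a
  nonmeasurable function would silently be zero.
\<close>
primrec gd_iter ::
  "real \<Rightarrow> real \<Rightarrow> 'a::euclidean_space measure \<Rightarrow> 'a measure \<Rightarrow> ('a \<Rightarrow> real) \<Rightarrow> ('a \<Rightarrow> real) \<Rightarrow>
   nat \<Rightarrow> ('a \<Rightarrow> real) \<times> ('a \<Rightarrow> real)" where
  "gd_iter \<epsilon> \<eta> P Q f0 g0 0 =
     (\<lambda>x. if x \<in> topological_support P then f0 x else 0,
      \<lambda>y. if y \<in> topological_support Q then g0 y else 0)"
| "gd_iter \<epsilon> \<eta> P Q f0 g0 (Suc n) =
     (let (f, g) = gd_iter \<epsilon> \<eta> P Q f0 g0 n in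
       (\<lambda>x. if x \<in> topological_support P
             then f x + \<eta> * (1 - 1 / \<epsilon> * (\<integral>y. qot_excess f g x y \<partial>Q)) else 0,
        \<lambda>y. if y \<in> topological_support Q
             then g y + \<eta> * (1 - 1 / \<epsilon> * (\<integral>x. qot_excess f g x y \<partial>P)) else 0))"

end

theory Submission
  imports Defs
begin

text \<open>
  Write \<open>c(x,y) = |x - y|\<^sup>2/2\<close>, \<open>z\<^sub>n = f\<^sub>n + g\<^sub>n - c\<close> and \<open>z\<^sub>* = f\<^sub>* + g\<^sub>* - c\<close>, and let
  \<open>u = f\<^sub>n - f\<^sub>*\<close> and \<open>v = g\<^sub>n - g\<^sub>*\<close> be the errors. Since the optimal plan has the right marginals,
  \<open>\<integral>(z\<^sub>*)\<^sub>+ dQ = \<epsilon>\<close> for \<open>P\<close>-almost every \<open>x\<close>, and similarly in \<open>y\<close>. With \<open>t = \<eta>/\<epsilon> < 1\<close> and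
  \<open>h = (z\<^sub>n)\<^sub>+ - (z\<^sub>*)\<^sub>+\<close>, a gradient step therefore replaces \<open>u\<close> by \<open>u - t\<integral>h dQ\<close> and \<open>v\<close> by
  \<open>v - t\<integral>h dP\<close>. Because \<open>h\<^sup>2 \<le> h(u + v)\<close>, this decreases \<open>\<parallel>u\<parallel>\<^sup>2 + \<parallel>v\<parallel>\<^sup>2\<close> by at least
  \<open>2t(1 - t)\<integral>h(u + v)\<close> (\<open>gradient_step_descent\<close>, \<open>gd_step_descent\<close>). Geometric decay of the error
  follows once \<open>\<integral>h(u + v)\<close> is bounded below by a fixed multiple of \<open>\<parallel>u\<parallel>\<^sup>2 + \<parallel>v\<parallel>\<^sup>2\<close>, for which
  there are three ingredients.

  First, the potentials are Lipschitz on a set of full measure, by comparison of the first order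
  conditions at two points (\<open>potential_le\<close>). As \<open>(z\<^sub>*)\<^sub>+\<close> has mean \<open>\<epsilon>\<close> on every section, the set
  \<open>S = {z\<^sub>* \<ge> \<epsilon>/2}\<close> contains, up to null sets, a box over every point of either
  support (\<open>positive_excess_box\<close>).

  Second, such a set supports a Poincare type inequality: the integral of \<open>(u + v)\<^sup>2\<close> over \<open>S\<close>
  dominates a multiple of \<open>\<parallel>u\<parallel>\<^sup>2 + \<parallel>v\<parallel>\<^sup>2\<close> on the space of pairs with equal means
  (\<open>spectral_gap\<close>). This is where the support of \<open>Q\<close> has to be connected: the boxes chain together
  and force \<open>v\<close> to be nearly constant, \<open>u\<close> to be nearly the opposite constant, and equality of
  the means then makes this constant small.

  Third, on \<open>S\<close> the quotient \<open>h/(u + v)\<close> is bounded away from zero, not only near the limit: it is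
  enough that \<open>z\<^sub>n\<close> is bounded below uniformly in \<open>n\<close> (\<open>pos_part_strongly_monotone\<close>). The bound
  comes from the descent itself, which controls the means of \<open>f\<^sub>n\<close> and \<open>g\<^sub>n\<close>; these
  control the iterates from above (\<open>gd_step_le\<close>), and the upper bounds control them from below
  (\<open>gd_step_ge\<close>). Hence the error contracts by a fixed factor in every step, and a slightly
  larger factor absorbs the multiplicative constant after finitely many steps
  (\<open>geometric_decay\<close>).
\<close>

section \<open>Topological supports\<close>

lemma closed_topological_support: "closed (topological_support M)"
proof -
  have "- topological_support M = \<Union>{U. open U \<and> emeasure M U = 0}"
    by (auto simp: topological_support_def zero_less_iff_neq_zero)
  then have "open (- topological_support M)"
    by (simp add: open_Union)
  then show ?thesis by (simp add: closed_open)
qed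

lemma topological_support_in_sets:
  "sets M = sets borel \<Longrightarrow> topological_support M \<in> sets M"
  using closed_topological_support[of M] by auto

text \<open>The complement is a union of open null sets; by second countability countably many
  of them suffice.\<close>
lemma AE_topological_support:
  fixes M :: "'a::second_countable_topology measure"
  assumes M: "sets M = sets borel"
  shows "AE x in M. x \<in> topological_support M"
proof -
  define \<F> where "\<F> = {U. open U \<and> emeasure M U = 0}"
  obtain \<F>' where \<F>': "\<F>' \<subseteq> \<F>" "countable \<F>'" "\<Union>\<F>' = \<Union>\<F>"
    using Lindelof[of \<F>] by (auto simp: \<F>_def)
  have "(\<Union>U\<in>\<F>'. U) \<in> null_sets M"
    using \<F>' by (intro null_sets_UN') (auto simp: \<F>_def null_sets_def M)
  moreover have "- topological_support M = \<Union>\<F>"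
    by (auto simp: topological_support_def \<F>_def zero_less_iff_neq_zero)
  ultimately have "- topological_support M \<in> null_sets M"
    using \<F>' by simp
  then show ?thesis
    by (intro AE_I'[of "- topological_support M"]) auto
qed

text \<open>Every neighborhood of a point of the support has positive mass, so it meets every set of full
  measure.\<close>
lemma AE_topological_support_obtain:
  assumes M: "sets M = sets borel" and ae: "AE x in M. R x"
    and U: "open U" "x \<in> U" "x \<in> topological_support M"
  obtains x' where "x' \<in> U" "R x'"
proof -
  have "\<not> (AE x in M. x \<notin> U)"
  proof
    assume "AE x in M. x \<notin> U"
    then have "emeasure M U = 0"
      using U M sets_eq_imp_space_eq[OF M] by (subst (asm) AE_iff_measurable[of U]) auto
    then show False using U by (auto simp: topological_support_def)
  qed
  moreover have "AE x in M. x \<notin> U" if "AE x in M. \<not> (x \<in> U \<and> R x)"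
    using ae that by eventually_elim auto
  ultimately have "\<not> (AE x in M. \<not> (x \<in> U \<and> R x))" by blast
  then show thesis using that by (metis (mono_tags, lifting) AE_I2)
qed

section \<open>Square integrable functions on a product of probability spaces\<close>

lemma square_integrable_mult:
  assumes "square_integrable M f" "square_integrable M g"
  shows "integrable M (\<lambda>x. f x * g x)"
proof (rule Bochner_Integration.integrable_bound)
  show "integrable M (\<lambda>x. (f x)\<^sup>2 + (g x)\<^sup>2)"
    using assms by (auto simp: square_integrable_def)
  show "(\<lambda>x. f x * g x) \<in> borel_measurable M"
    using assms by (auto simp: square_integrable_def)
  show "AE x in M. norm (f x * g x) \<le> norm ((f x)\<^sup>2 + (g x)\<^sup>2)"
  proof (rule AE_I2)
    fix x
    have "2 * (\<bar>f x\<bar> * \<bar>g x\<bar>) \<le> (f x)\<^sup>2 + (g x)\<^sup>2"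
      using sum_squares_bound[of "\<bar>f x\<bar>" "\<bar>g x\<bar>"] by simp
    moreover have "0 \<le> \<bar>f x\<bar> * \<bar>g x\<bar>" by simp
    ultimately show "norm (f x * g x) \<le> norm ((f x)\<^sup>2 + (g x)\<^sup>2)"
      unfolding real_norm_def abs_mult by linarith
  qed
qed

lemma square_integrable_add:
  assumes "square_integrable M f" "square_integrable M g"
  shows "square_integrable M (\<lambda>x. f x + g x)"
  unfolding square_integrable_def
proof (intro conjI)
  have "integrable M (\<lambda>x. (f x)\<^sup>2 + (g x)\<^sup>2 + 2 * (f x * g x))"
    using assms square_integrable_mult[OF assms] unfolding square_integrable_def
    by (intro Bochner_Integration.integrable_add integrable_mult_right) blast+
  then show "integrable M (\<lambda>x. (f x + g x)\<^sup>2)"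
    by (simp add: power2_sum mult.assoc)
qed (use assms in \<open>auto simp: square_integrable_def\<close>)

lemma square_integrable_cmult:
  "square_integrable M f \<Longrightarrow> square_integrable M (\<lambda>x. c * f x)"
  by (auto simp: square_integrable_def power_mult_distrib)

lemma square_integrable_diff:
  assumes "square_integrable M f" "square_integrable M g"
  shows "square_integrable M (\<lambda>x. f x - g x)"
  using square_integrable_add[OF assms(1) square_integrable_cmult[OF assms(2), of "-1"]] by simp

lemma square_integrable_bound:
  assumes "square_integrable M f" "g \<in> borel_measurable M" "\<And>x. \<bar>g x\<bar> \<le> \<bar>f x\<bar>"
  shows "square_integrable M g"
  unfolding square_integrable_def
proof (intro conjI)
  show "integrable M (\<lambda>x. (g x)\<^sup>2)"
  proof (rule Bochner_Integration.integrable_bound)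
    have "(g x)\<^sup>2 \<le> (f x)\<^sup>2" for x
      using assms(3) by (simp only: abs_le_square_iff)
    then show "AE x in M. norm ((g x)\<^sup>2) \<le> norm ((f x)\<^sup>2)" by simp
  qed (use assms in \<open>auto simp: square_integrable_def\<close>)
qed fact

lemma (in prob_space) square_integrable_bounded:
  assumes "g \<in> borel_measurable M" "\<And>x. \<bar>g x\<bar> \<le> B"
  shows "square_integrable M g"
proof (rule square_integrable_bound[of _ "\<lambda>_. B"])
  show "\<bar>g x\<bar> \<le> \<bar>B\<bar>" for x using assms(2)[of x] by linarith
qed (use assms in \<open>auto simp: square_integrable_def\<close>)

lemma (in prob_space) square_integrable_integrable:
  "square_integrable M f \<Longrightarrow> integrable M f"
  by (auto simp: square_integrable_def intro: square_integrable_imp_integrable)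

lemma (in prob_space) expectation_square_le:
  assumes "square_integrable M f"
  shows "(expectation f)\<^sup>2 \<le> expectation (\<lambda>x. (f x)\<^sup>2)"
proof -
  have "integrable M f" by (rule square_integrable_integrable[OF assms])
  then have "variance f = expectation (\<lambda>x. (f x)\<^sup>2) - (expectation f)\<^sup>2"
    using assms by (intro variance_eq) (simp_all add: square_integrable_def)
  then show ?thesis
    using variance_positive[of f] by linarith
qed

context pair_prob_space
begin

lemma integral_comp_fst:
  fixes f :: "'a \<Rightarrow> real"
  assumes "f \<in> borel_measurable M1"
  shows "(\<integral>z. f (fst z) \<partial>(M1 \<Otimes>\<^sub>M M2)) = integral\<^sup>L M1 f"
  using integral_distr[OF measurable_fst assms, of M2] by (simp add: M2.distr_pair_fst)

lemma integrable_comp_fst: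
  fixes f :: "'a \<Rightarrow> real"
  assumes "integrable M1 f"
  shows "integrable (M1 \<Otimes>\<^sub>M M2) (\<lambda>z. f (fst z))"
  using assms integrable_distr_eq[OF measurable_fst, of f M1 M2] by (simp add: M2.distr_pair_fst)

lemma distr_pair_snd: "distr (M1 \<Otimes>\<^sub>M M2) M2 snd = M2"
proof -
  have "distr (M1 \<Otimes>\<^sub>M M2) M2 snd = distr (M2 \<Otimes>\<^sub>M M1) M2 fst"
    by (subst distr_pair_swap, subst distr_distr) (auto simp: o_def case_prod_beta)
  then show ?thesis by (simp add: M1.distr_pair_fst)
qed

lemma integral_comp_snd:
  fixes f :: "'b \<Rightarrow> real"
  assumes "f \<in> borel_measurable M2"
  shows "(\<integral>z. f (snd z) \<partial>(M1 \<Otimes>\<^sub>M M2)) = integral\<^sup>L M2 f"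
  using integral_distr[OF measurable_snd assms, of M1] by (simp add: distr_pair_snd)

lemma integrable_comp_snd:
  fixes f :: "'b \<Rightarrow> real"
  assumes "integrable M2 f"
  shows "integrable (M1 \<Otimes>\<^sub>M M2) (\<lambda>z. f (snd z))"
  using assms integrable_distr_eq[OF measurable_snd, of f M2 M1] by (simp add: distr_pair_snd)

lemma square_integrable_comp_fst:
  "square_integrable M1 f \<Longrightarrow> square_integrable (M1 \<Otimes>\<^sub>M M2) (\<lambda>z. f (fst z))"
  unfolding square_integrable_def using integrable_comp_fst[of "\<lambda>x. (f x)\<^sup>2"] by auto

lemma square_integrable_comp_snd:
  "square_integrable M2 f \<Longrightarrow> square_integrable (M1 \<Otimes>\<^sub>M M2) (\<lambda>z. f (snd z))"
  unfolding square_integrable_def using integrable_comp_snd[of "\<lambda>x. (f x)\<^sup>2"] by auto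

lemma AE_pair_fst: "AE x in M1. R x \<Longrightarrow> AE z in M1 \<Otimes>\<^sub>M M2. R (fst z)"
  by (rule AE_distrD[OF measurable_fst, of R M1 M2, unfolded M2.distr_pair_fst])

lemma AE_pair_snd: "AE y in M2. R y \<Longrightarrow> AE z in M1 \<Otimes>\<^sub>M M2. R (snd z)"
  by (rule AE_distrD[OF measurable_snd, of R M1 M2, unfolded distr_pair_snd])

text \<open>Integrating out one variable is a contraction of \<open>L\<^sup>2\<close> by Jensen's inequality, and it is
  adjoint to the embedding of functions of one variable.\<close>
lemma fst_marginal_square_integrable:
  assumes h: "square_integrable (M1 \<Otimes>\<^sub>M M2) h"
  defines "H \<equiv> \<lambda>x. \<integral>y. h (x, y) \<partial>M2"
  shows "square_integrable M1 H"
    and "(\<integral>x. (H x)\<^sup>2 \<partial>M1) \<le> (\<integral>z. (h z)\<^sup>2 \<partial>(M1 \<Otimes>\<^sub>M M2))"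
    and "integral\<^sup>L M1 H = integral\<^sup>L (M1 \<Otimes>\<^sub>M M2) h"
    and "square_integrable M1 u \<Longrightarrow>
      (\<integral>x. u x * H x \<partial>M1) = (\<integral>z. u (fst z) * h z \<partial>(M1 \<Otimes>\<^sub>M M2))"
proof -
  have hm[measurable]: "h \<in> borel_measurable (M1 \<Otimes>\<^sub>M M2)"
    and h2: "integrable (M1 \<Otimes>\<^sub>M M2) (\<lambda>z. (h z)\<^sup>2)"
    using h by (auto simp: square_integrable_def)
  have h1: "integrable (M1 \<Otimes>\<^sub>M M2) h"
    by (rule square_integrable_integrable[OF h])
  have Hm[measurable]: "H \<in> borel_measurable M1"
    unfolding H_def by measurable
  have Jensen: "AE x in M1. (H x)\<^sup>2 \<le> (\<integral>y. (h (x, y))\<^sup>2 \<partial>M2)"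
    using AE_integrable_fst'[OF h2] AE_space
  proof eventually_elim
    case (elim x)
    then show ?case unfolding H_def
      by (intro M2.expectation_square_le) (auto simp: square_integrable_def)
  qed
  have i: "integrable M1 (\<lambda>x. \<integral>y. (h (x, y))\<^sup>2 \<partial>M2)"
    by (rule integrable_fst'[OF h2])
  have H2: "integrable M1 (\<lambda>x. (H x)\<^sup>2)"
    by (rule Bochner_Integration.integrable_bound[OF i]) (use Jensen in \<open>auto elim!: eventually_mono\<close>)
  then show "square_integrable M1 H" by (simp add: square_integrable_def)
  have "(\<integral>x. (H x)\<^sup>2 \<partial>M1) \<le> (\<integral>x. (\<integral>y. (h (x, y))\<^sup>2 \<partial>M2) \<partial>M1)"
    by (rule integral_mono_AE[OF H2 i Jensen])
  also have "\<dots> = (\<integral>z. (h z)\<^sup>2 \<partial>(M1 \<Otimes>\<^sub>M M2))"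
    by (rule integral_fst'[OF h2])
  finally show "(\<integral>x. (H x)\<^sup>2 \<partial>M1) \<le> (\<integral>z. (h z)\<^sup>2 \<partial>(M1 \<Otimes>\<^sub>M M2))" .
  show "integral\<^sup>L M1 H = integral\<^sup>L (M1 \<Otimes>\<^sub>M M2) h"
    unfolding H_def by (rule integral_fst'[OF h1])
  assume u: "square_integrable M1 u"
  have "integrable (M1 \<Otimes>\<^sub>M M2) (\<lambda>z. u (fst z) * h z)"
    by (rule square_integrable_mult[OF square_integrable_comp_fst[OF u] h])
  from integral_fst'[OF this]
  show "(\<integral>x. u x * H x \<partial>M1) = (\<integral>z. u (fst z) * h z \<partial>(M1 \<Otimes>\<^sub>M M2))"
    by (simp add: H_def)
qed

lemma snd_marginal_square_integrable:
  assumes h: "square_integrable (M1 \<Otimes>\<^sub>M M2) h"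
  defines "H \<equiv> \<lambda>y. \<integral>x. h (x, y) \<partial>M1"
  shows "square_integrable M2 H"
    and "(\<integral>y. (H y)\<^sup>2 \<partial>M2) \<le> (\<integral>z. (h z)\<^sup>2 \<partial>(M1 \<Otimes>\<^sub>M M2))"
    and "integral\<^sup>L M2 H = integral\<^sup>L (M1 \<Otimes>\<^sub>M M2) h"
    and "square_integrable M2 v \<Longrightarrow>
      (\<integral>y. v y * H y \<partial>M2) = (\<integral>z. v (snd z) * h z \<partial>(M1 \<Otimes>\<^sub>M M2))"
proof -
  interpret S: pair_prob_space M2 M1 ..
  have swap: "(\<integral>z. k (snd z, fst z) \<partial>(M2 \<Otimes>\<^sub>M M1)) = integral\<^sup>L (M1 \<Otimes>\<^sub>M M2) k"
    if "k \<in> borel_measurable (M1 \<Otimes>\<^sub>M M2)" for k :: "'a \<times> 'b \<Rightarrow> real"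
    using integral_product_swap[OF that] by (simp add: case_prod_unfold)
  have hm[measurable]: "h \<in> borel_measurable (M1 \<Otimes>\<^sub>M M2)"
    and h2: "integrable (M1 \<Otimes>\<^sub>M M2) (\<lambda>z. (h z)\<^sup>2)"
    using h by (auto simp: square_integrable_def)
  have sw: "square_integrable (M2 \<Otimes>\<^sub>M M1) (\<lambda>z. h (snd z, fst z))"
    using integrable_product_swap[OF h2] by (auto simp: square_integrable_def case_prod_unfold)
  note * = S.fst_marginal_square_integrable[OF sw, simplified]
  show "square_integrable M2 H" unfolding H_def by (rule *(1))
  show "(\<integral>y. (H y)\<^sup>2 \<partial>M2) \<le> (\<integral>z. (h z)\<^sup>2 \<partial>(M1 \<Otimes>\<^sub>M M2))"
    using *(2) swap[of "\<lambda>z. (h z)\<^sup>2"] by (simp add: H_def)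
  show "integral\<^sup>L M2 H = integral\<^sup>L (M1 \<Otimes>\<^sub>M M2) h"
    using *(3) swap[of h] by (simp add: H_def)
  assume v: "square_integrable M2 v"
  then have [measurable]: "v \<in> borel_measurable M2" by (simp add: square_integrable_def)
  show "(\<integral>y. v y * H y \<partial>M2) = (\<integral>z. v (snd z) * h z \<partial>(M1 \<Otimes>\<^sub>M M2))"
    using *(4)[OF v] swap[of "\<lambda>z. v (snd z) * h z"] by (simp add: H_def)
qed

end

section \<open>One step of the descent\<close>

text \<open>Expanding the squares, the cross term is \<open>-2t\<integral>hD\<close> with
  \<open>D(x,y) = u(x) + v(y)\<close>. Each of the two quadratic terms is at most \<open>t\<^sup>2\<integral>h\<^sup>2\<close> by Jensen's
  inequality, and \<open>h\<^sup>2 \<le> hD\<close> absorbs them into the cross term. In the application \<open>h\<close> is the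
  increment of the positive part, so that \<open>h\<^sup>2 \<le> hD\<close> says that the positive part is monotone
  with Lipschitz constant one, and \<open>\<integral>hD\<close> measures the decrease of the error.\<close>
lemma gradient_step_descent:
  fixes P Q :: "'a measure" and h :: "'a \<times> 'a \<Rightarrow> real" and t :: real
  assumes "prob_space P" "prob_space Q"
    and uv: "(u, v) \<in> L2sum P Q"
    and h[measurable]: "h \<in> borel_measurable (P \<Otimes>\<^sub>M Q)"
    and h_le: "\<And>x y. (h (x, y))\<^sup>2 \<le> h (x, y) * (u x + v y)"
  defines "u' \<equiv> \<lambda>x. u x - t * (\<integral>y. h (x, y) \<partial>Q)"
    and "v' \<equiv> \<lambda>y. v y - t * (\<integral>x. h (x, y) \<partial>P)"
  shows "(u', v') \<in> L2sum P Q"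
    and "integrable (P \<Otimes>\<^sub>M Q) (\<lambda>z. h z * (u (fst z) + v (snd z)))"
    and "(\<integral>x. (u' x)\<^sup>2 \<partial>P) + (\<integral>y. (v' y)\<^sup>2 \<partial>Q) \<le> (\<integral>x. (u x)\<^sup>2 \<partial>P) + (\<integral>y. (v y)\<^sup>2 \<partial>Q)
      - 2 * t * (1 - t) * (\<integral>z. h z * (u (fst z) + v (snd z)) \<partial>(P \<Otimes>\<^sub>M Q))"
proof -
  interpret P: prob_space P by fact
  interpret Q: prob_space Q by fact
  interpret PQ: pair_prob_space P Q ..
  have u: "square_integrable P u" and v: "square_integrable Q v"
    and eq: "integral\<^sup>L P u = integral\<^sup>L Q v"
    using uv by (auto simp: L2sum_def)
  have D: "square_integrable (P \<Otimes>\<^sub>M Q) (\<lambda>z. u (fst z) + v (snd z))"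
    by (intro square_integrable_add PQ.square_integrable_comp_fst PQ.square_integrable_comp_snd u v)
  have h_le': "(h z)\<^sup>2 \<le> h z * (u (fst z) + v (snd z))" for z
    using h_le[of "fst z" "snd z"] by simp
  have "\<bar>h z\<bar> \<le> \<bar>u (fst z) + v (snd z)\<bar>" for z
  proof (cases "h z = 0")
    case False
    have "\<bar>h z\<bar> * \<bar>h z\<bar> \<le> \<bar>h z\<bar> * \<bar>u (fst z) + v (snd z)\<bar>"
      using h_le'[of z] abs_ge_self[of "h z * (u (fst z) + v (snd z))"]
      unfolding abs_mult[symmetric] power2_eq_square[symmetric] power2_abs by linarith
    then show ?thesis by (rule mult_left_le_imp_le) (use False in simp)
  qed simp
  then have hs: "square_integrable (P \<Otimes>\<^sub>M Q) h"
    by (rule square_integrable_bound[OF D h])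
  define H K where "H = (\<lambda>x. \<integral>y. h (x, y) \<partial>Q)" and "K = (\<lambda>y. \<integral>x. h (x, y) \<partial>P)"
  have Hf: "square_integrable P H" "(\<integral>x. (H x)\<^sup>2 \<partial>P) \<le> (\<integral>z. (h z)\<^sup>2 \<partial>(P \<Otimes>\<^sub>M Q))"
    "integral\<^sup>L P H = integral\<^sup>L (P \<Otimes>\<^sub>M Q) h"
    "(\<integral>x. u x * H x \<partial>P) = (\<integral>z. u (fst z) * h z \<partial>(P \<Otimes>\<^sub>M Q))"
    using PQ.fst_marginal_square_integrable[OF hs] u unfolding H_def by blast+
  have Kf: "square_integrable Q K" "(\<integral>y. (K y)\<^sup>2 \<partial>Q) \<le> (\<integral>z. (h z)\<^sup>2 \<partial>(P \<Otimes>\<^sub>M Q))"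
    "integral\<^sup>L Q K = integral\<^sup>L (P \<Otimes>\<^sub>M Q) h"
    "(\<integral>y. v y * K y \<partial>Q) = (\<integral>z. v (snd z) * h z \<partial>(P \<Otimes>\<^sub>M Q))"
    using PQ.snd_marginal_square_integrable[OF hs] v unfolding K_def by blast+
  have u': "u' = (\<lambda>x. u x - t * H x)" and v': "v' = (\<lambda>y. v y - t * K y)"
    by (simp_all add: u'_def v'_def H_def K_def)
  show "(u', v') \<in> L2sum P Q"
    using u v Hf Kf eq unfolding L2sum_def u' v'
    by (auto intro!: square_integrable_diff square_integrable_cmult
        simp: P.square_integrable_integrable Q.square_integrable_integrable)
  show hD: "integrable (P \<Otimes>\<^sub>M Q) (\<lambda>z. h z * (u (fst z) + v (snd z)))"
    by (rule square_integrable_mult[OF hs D])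
  have expand: "(\<integral>x. (a x - t * b x)\<^sup>2 \<partial>M) = (\<integral>x. (a x)\<^sup>2 \<partial>M) - 2 * t * (\<integral>x. a x * b x \<partial>M) + t\<^sup>2 * (\<integral>x. (b x)\<^sup>2 \<partial>M)"
    if "square_integrable M a" "square_integrable M b" for a b :: "'a \<Rightarrow> real" and M
  proof -
    have "(\<integral>x. (a x - t * b x)\<^sup>2 \<partial>M) = (\<integral>x. (a x)\<^sup>2 - 2 * t * (a x * b x) + t\<^sup>2 * (b x)\<^sup>2 \<partial>M)"
      by (intro Bochner_Integration.integral_cong) (auto simp: power2_eq_square algebra_simps)
    also have "\<dots> = (\<integral>x. (a x)\<^sup>2 \<partial>M) - 2 * t * (\<integral>x. a x * b x \<partial>M) + t\<^sup>2 * (\<integral>x. (b x)\<^sup>2 \<partial>M)"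
      using that square_integrable_mult[OF that] by (simp add: square_integrable_def)
    finally show ?thesis .
  qed
  have "integrable (P \<Otimes>\<^sub>M Q) (\<lambda>z. u (fst z) * h z)" "integrable (P \<Otimes>\<^sub>M Q) (\<lambda>z. v (snd z) * h z)"
    by (intro square_integrable_mult hs PQ.square_integrable_comp_fst PQ.square_integrable_comp_snd u v)+
  then have cross: "(\<integral>x. u x * H x \<partial>P) + (\<integral>y. v y * K y \<partial>Q) = (\<integral>z. h z * (u (fst z) + v (snd z)) \<partial>(P \<Otimes>\<^sub>M Q))"
    using Hf(4) Kf(4) by (simp add: algebra_simps)
  have "(\<integral>z. (h z)\<^sup>2 \<partial>(P \<Otimes>\<^sub>M Q)) \<le> (\<integral>z. h z * (u (fst z) + v (snd z)) \<partial>(P \<Otimes>\<^sub>M Q))"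
    using hs hD h_le' by (intro integral_mono) (auto simp: square_integrable_def)
  then have "t\<^sup>2 * ((\<integral>x. (H x)\<^sup>2 \<partial>P) + (\<integral>y. (K y)\<^sup>2 \<partial>Q))
    \<le> t\<^sup>2 * (2 * (\<integral>z. h z * (u (fst z) + v (snd z)) \<partial>(P \<Otimes>\<^sub>M Q)))"
    using Hf(2) Kf(2) by (intro mult_left_mono) auto
  then show "(\<integral>x. (u' x)\<^sup>2 \<partial>P) + (\<integral>y. (v' y)\<^sup>2 \<partial>Q) \<le> (\<integral>x. (u x)\<^sup>2 \<partial>P) + (\<integral>y. (v y)\<^sup>2 \<partial>Q)
      - 2 * t * (1 - t) * (\<integral>z. h z * (u (fst z) + v (snd z)) \<partial>(P \<Otimes>\<^sub>M Q))"
    unfolding u' v' expand[OF u Hf(1)] expand[OF v Kf(1)] cross[symmetric]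
    by (simp add: algebra_simps power2_eq_square)
qed

section \<open>Spectral gap\<close>

text \<open>Extended nonnegative integrals keep the chaining estimates below free of integrability
  side conditions.\<close>
definition block_gap ::
  "'a measure \<Rightarrow> 'b measure \<Rightarrow> 'a set \<Rightarrow> 'b set \<Rightarrow> ('a \<Rightarrow> real) \<Rightarrow> ('b \<Rightarrow> real) \<Rightarrow> ennreal" where
  "block_gap M N A B a b =
    (\<integral>\<^sup>+z. ennreal ((a (fst z) - b (snd z))\<^sup>2) * indicator (A \<times> B) z \<partial>(M \<Otimes>\<^sub>M N))"

lemma block_gap_iterated:
  assumes "prob_space M" "prob_space N"
    and [measurable]: "a \<in> borel_measurable M" "b \<in> borel_measurable N" "A \<in> sets M" "B \<in> sets N"
  shows "block_gap M N A B a b =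
    (\<integral>\<^sup>+x. \<integral>\<^sup>+y. ennreal ((a x - b y)\<^sup>2) * (indicator A x * indicator B y) \<partial>N \<partial>M)"
proof -
  interpret N: prob_space N by fact
  show ?thesis unfolding block_gap_def
    by (subst N.nn_integral_fst[symmetric]) (simp_all add: indicator_times)
qed

lemma block_gap_swap:
  assumes "prob_space M" "prob_space N"
    and [measurable]: "a \<in> borel_measurable M" "b \<in> borel_measurable N" "A \<in> sets M" "B \<in> sets N"
  shows "block_gap M N A B a b = block_gap N M B A b a"
proof -
  interpret M: prob_space M by fact
  interpret N: prob_space N by fact
  interpret MN: pair_prob_space M N ..
  have "block_gap M N A B a b =
    (\<integral>\<^sup>+y. \<integral>\<^sup>+x. ennreal ((a x - b y)\<^sup>2) * (indicator A x * indicator B y) \<partial>M \<partial>N)"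
    unfolding block_gap_def
    by (subst MN.nn_integral_snd[symmetric]) (simp_all add: indicator_times)
  also have "\<dots> = block_gap N M B A b a"
    using assms by (subst block_gap_iterated) (auto simp: power2_commute mult.commute)
  finally show ?thesis .
qed

lemma block_gap_mono:
  "A \<subseteq> A' \<Longrightarrow> B \<subseteq> B' \<Longrightarrow> block_gap M N A B a b \<le> block_gap M N A' B' a b"
  unfolding block_gap_def
  by (intro nn_integral_mono mult_left_mono) (auto simp: indicator_def)

text \<open>Integrate \<open>(a - c)\<^sup>2 \<le> 2(a - b)\<^sup>2 + 2(b - c)\<^sup>2\<close> over the product of the three sets: if \<open>a\<close> is close
  to \<open>b\<close> and \<open>b\<close> is close to \<open>c\<close> in mean square, then \<open>a\<close> is close to \<open>c\<close>, provided that the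
  intermediate set has positive mass. The factor \<open>emeasure M2 B\<close> on the left makes the estimate
  true, and useless, on null sets.\<close>
lemma block_gap_chain:
  assumes "prob_space M1" "prob_space M2" "prob_space M3"
    and [measurable]: "a \<in> borel_measurable M1" "b \<in> borel_measurable M2" "c \<in> borel_measurable M3"
      "A \<in> sets M1" "B \<in> sets M2" "C \<in> sets M3"
  shows "emeasure M2 B * block_gap M1 M3 A C a c
    \<le> 2 * block_gap M1 M2 A B a b + 2 * block_gap M2 M3 B C b c"
proof -
  interpret M1: prob_space M1 by fact
  interpret M2: prob_space M2 by fact
  interpret M3: prob_space M3 by fact
  define \<Phi> where "\<Phi> x = (\<integral>\<^sup>+y. ennreal ((a x - b y)\<^sup>2) * (indicator A x * indicator B y) \<partial>M2)" for x
  define \<Psi> where "\<Psi> z = (\<integral>\<^sup>+y. ennreal ((c z - b y)\<^sup>2) * (indicator C z * indicator B y) \<partial>M2)" for z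
  have [measurable]: "\<Phi> \<in> borel_measurable M1" "\<Psi> \<in> borel_measurable M3"
    unfolding \<Phi>_def \<Psi>_def by measurable
  have le: "ennreal ((a x - c z)\<^sup>2) * (indicator A x * indicator C z) * indicator B y
    \<le> 2 * (ennreal ((a x - b y)\<^sup>2) * (indicator A x * indicator B y))
      + 2 * (ennreal ((c z - b y)\<^sup>2) * (indicator C z * indicator B y))" for x y z
  proof -
    have "(a x - c z)\<^sup>2 \<le> 2 * (a x - b y)\<^sup>2 + 2 * (c z - b y)\<^sup>2"
      using sum_squares_bound[of "a x - b y" "b y - c z"]
      by (simp add: power2_eq_square algebra_simps)
    then have "ennreal ((a x - c z)\<^sup>2) \<le> ennreal (2 * (a x - b y)\<^sup>2 + 2 * (c z - b y)\<^sup>2)"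
      by (rule ennreal_leI)
    also have "\<dots> = 2 * ennreal ((a x - b y)\<^sup>2) + 2 * ennreal ((c z - b y)\<^sup>2)"
      by (simp add: ennreal_plus ennreal_mult)
    finally show ?thesis by (auto simp: indicator_def)
  qed
  have inner: "ennreal ((a x - c z)\<^sup>2) * (indicator A x * indicator C z) * emeasure M2 B
    \<le> 2 * \<Phi> x + 2 * \<Psi> z" if "x \<in> space M1" "z \<in> space M3" for x z
  proof -
    have "ennreal ((a x - c z)\<^sup>2) * (indicator A x * indicator C z) * emeasure M2 B
      = (\<integral>\<^sup>+y. ennreal ((a x - c z)\<^sup>2) * (indicator A x * indicator C z) * indicator B y \<partial>M2)"
      by (simp add: nn_integral_cmult)
    also have "\<dots> \<le> (\<integral>\<^sup>+y. 2 * (ennreal ((a x - b y)\<^sup>2) * (indicator A x * indicator B y))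
      + 2 * (ennreal ((c z - b y)\<^sup>2) * (indicator C z * indicator B y)) \<partial>M2)"
      by (intro nn_integral_mono le)
    also have "\<dots> = 2 * \<Phi> x + 2 * \<Psi> z"
      unfolding \<Phi>_def \<Psi>_def by (subst nn_integral_add) (auto simp: nn_integral_cmult)
    finally show ?thesis .
  qed
  have "emeasure M2 B * block_gap M1 M3 A C a c =
    (\<integral>\<^sup>+x. \<integral>\<^sup>+z. ennreal ((a x - c z)\<^sup>2) * (indicator A x * indicator C z) * emeasure M2 B \<partial>M3 \<partial>M1)"
    using assms by (simp add: block_gap_iterated nn_integral_cmult mult.commute)
  also have "\<dots> \<le> (\<integral>\<^sup>+x. \<integral>\<^sup>+z. 2 * \<Phi> x + 2 * \<Psi> z \<partial>M3 \<partial>M1)"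
    by (intro nn_integral_mono inner)
  also have "\<dots> = 2 * (\<integral>\<^sup>+x. \<Phi> x \<partial>M1) + 2 * (\<integral>\<^sup>+z. \<Psi> z \<partial>M3)"
    by (simp add: nn_integral_add nn_integral_cmult M1.emeasure_space_1 M3.emeasure_space_1)
  also have "(\<integral>\<^sup>+x. \<Phi> x \<partial>M1) = block_gap M1 M2 A B a b"
    using assms by (subst block_gap_iterated) (auto simp: \<Phi>_def[abs_def])
  also have "(\<integral>\<^sup>+z. \<Psi> z \<partial>M3) = block_gap M2 M3 B C b c"
    using assms by (subst block_gap_swap, simp_all, subst block_gap_iterated) (auto simp: \<Psi>_def[abs_def])
  finally show ?thesis .
qed

text \<open>Estimates that hold near every point of a compact set, uniformly in a parameter \<open>i\<close>, add up
  over a finite subcover. The parameter will be the pair \<open>(u, v)\<close>, the constant being independent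
  of it.\<close>
lemma compact_local_bound:
  fixes \<phi> :: "'i \<Rightarrow> 'b::topological_space \<Rightarrow> ennreal" and e :: "'i \<Rightarrow> ennreal"
  assumes K: "compact K" and N: "sets N = sets borel"
    and \<phi>: "\<And>i. i \<in> I \<Longrightarrow> \<phi> i \<in> borel_measurable N"
    and loc: "\<And>z. z \<in> K \<Longrightarrow> \<exists>U C. open U \<and> z \<in> U \<and> 0 \<le> (C::real) \<and>
      (\<forall>i\<in>I. (\<integral>\<^sup>+w. \<phi> i w * indicator U w \<partial>N) \<le> ennreal C * e i)"
  shows "\<exists>C\<ge>0. \<forall>i\<in>I. (\<integral>\<^sup>+w. \<phi> i w * indicator K w \<partial>N) \<le> ennreal C * e i"
proof -
  define good where "good z U C \<longleftrightarrow> open U \<and> z \<in> U \<and> 0 \<le> (C::real) \<and>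
    (\<forall>i\<in>I. (\<integral>\<^sup>+w. \<phi> i w * indicator U w \<partial>N) \<le> ennreal C * e i)" for z U C
  have "\<forall>z\<in>K. \<exists>U C. good z U C"
    using loc unfolding good_def by blast
  then obtain U C where "\<forall>z\<in>K. good z (U z) (C z)"
    by metis
  then have UC: "\<And>z. z \<in> K \<Longrightarrow> open (U z)" "\<And>z. z \<in> K \<Longrightarrow> z \<in> U z"
    "\<And>z. z \<in> K \<Longrightarrow> 0 \<le> C z"
    "\<And>z i. z \<in> K \<Longrightarrow> i \<in> I \<Longrightarrow> (\<integral>\<^sup>+w. \<phi> i w * indicator (U z) w \<partial>N) \<le> ennreal (C z) * e i"
    by (simp_all add: good_def)
  obtain D where D: "D \<subseteq> K" "finite D" "K \<subseteq> (\<Union>z\<in>D. U z)"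
    by (rule compactE_image[OF K, of K U]) (use UC in blast)+
  have "(\<integral>\<^sup>+w. \<phi> i w * indicator K w \<partial>N) \<le> ennreal (\<Sum>z\<in>D. C z) * e i" if i: "i \<in> I" for i
  proof -
    have "\<phi> i w * indicator K w \<le> (\<Sum>z\<in>D. \<phi> i w * indicator (U z) w)" for w
    proof (cases "w \<in> K")
      case True
      then obtain z where "z \<in> D" "w \<in> U z" using D by auto
      then show ?thesis
        using member_le_sum[of z D "\<lambda>z. \<phi> i w * indicator (U z) w"] D True by simp
    qed simp
    then have "(\<integral>\<^sup>+w. \<phi> i w * indicator K w \<partial>N) \<le> (\<integral>\<^sup>+w. (\<Sum>z\<in>D. \<phi> i w * indicator (U z) w) \<partial>N)"
      by (intro nn_integral_mono)
    also have "\<dots> = (\<Sum>z\<in>D. \<integral>\<^sup>+w. \<phi> i w * indicator (U z) w \<partial>N)"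
      using UC(1) D(1) \<phi>[OF i]
      by (intro nn_integral_sum borel_measurable_times_ennreal borel_measurable_indicator) (auto simp: N)
    also have "\<dots> \<le> (\<Sum>z\<in>D. ennreal (C z) * e i)"
      using UC(4) D(1) i by (intro sum_mono) auto
    also have "\<dots> = ennreal (\<Sum>z\<in>D. C z) * e i"
      using UC(3) D(1) by (subst sum_ennreal[symmetric]) (auto simp: sum_distrib_right)
    finally show ?thesis .
  qed
  moreover have "0 \<le> (\<Sum>z\<in>D. C z)" using UC(3) D(1) by (auto intro: sum_nonneg)
  ultimately show ?thesis by blast
qed

lemma le_of_emeasure_mult_le:
  assumes "prob_space M" "emeasure M B \<noteq> 0" "0 \<le> k" "emeasure M B * X \<le> ennreal k * E"
  shows "X \<le> ennreal (k / measure M B) * E"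
proof -
  interpret prob_space M by fact
  have m: "0 < measure M B" and em: "emeasure M B = ennreal (measure M B)"
    using assms(2) by (auto simp: emeasure_eq_measure zero_less_measure_iff)
  have "X = ennreal (1 / measure M B) * (emeasure M B * X)"
    using m by (simp add: em mult.assoc[symmetric] ennreal_mult[symmetric])
  also have "\<dots> \<le> ennreal (1 / measure M B) * (ennreal k * E)"
    by (intro mult_left_mono assms) simp
  also have "\<dots> = ennreal (k / measure M B) * E"
    using m assms(3) by (simp add: mult.assoc[symmetric] ennreal_mult[symmetric])
  finally show ?thesis .
qed

text \<open>The constraint that both means agree makes the mixed term a square; the sum
  \<open>u(x) + v(y)\<close> therefore controls \<open>u\<close> and \<open>v\<close> separately.\<close>
lemma integral_square_add_L2sum:
  assumes "prob_space P" "prob_space Q" and uv: "(u, v) \<in> L2sum P Q"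
  shows "(\<integral>z. (u (fst z) + v (snd z))\<^sup>2 \<partial>(P \<Otimes>\<^sub>M Q))
    = (\<integral>x. (u x)\<^sup>2 \<partial>P) + (\<integral>y. (v y)\<^sup>2 \<partial>Q) + 2 * (integral\<^sup>L P u)\<^sup>2"
proof -
  interpret P: prob_space P by fact
  interpret Q: prob_space Q by fact
  interpret PQ: pair_prob_space P Q ..
  have u: "square_integrable P u" and v: "square_integrable Q v"
    and eq: "integral\<^sup>L P u = integral\<^sup>L Q v"
    using uv by (auto simp: L2sum_def)
  note us = PQ.square_integrable_comp_fst[OF u] and vs = PQ.square_integrable_comp_snd[OF v]
  have "(\<integral>z. (u (fst z) + v (snd z))\<^sup>2 \<partial>(P \<Otimes>\<^sub>M Q))
    = (\<integral>z. (u (fst z))\<^sup>2 + (v (snd z))\<^sup>2 + 2 * (u (fst z) * v (snd z)) \<partial>(P \<Otimes>\<^sub>M Q))"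
    by (simp add: power2_sum mult.assoc)
  also have "\<dots> = (\<integral>z. (u (fst z))\<^sup>2 \<partial>(P \<Otimes>\<^sub>M Q)) + (\<integral>z. (v (snd z))\<^sup>2 \<partial>(P \<Otimes>\<^sub>M Q))
    + 2 * (\<integral>z. u (fst z) * v (snd z) \<partial>(P \<Otimes>\<^sub>M Q))"
    using us vs square_integrable_mult[OF us vs] by (simp add: square_integrable_def)
  also have "(\<integral>z. u (fst z) * v (snd z) \<partial>(P \<Otimes>\<^sub>M Q)) = (integral\<^sup>L P u)\<^sup>2"
    using PQ.fst_marginal_square_integrable(4)[OF vs u] by (simp add: eq power2_eq_square)
  also have "(\<integral>z. (u (fst z))\<^sup>2 \<partial>(P \<Otimes>\<^sub>M Q)) = (\<integral>x. (u x)\<^sup>2 \<partial>P)"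
    using u by (intro PQ.integral_comp_fst[of "\<lambda>x. (u x)\<^sup>2"]) (auto simp: square_integrable_def)
  also have "(\<integral>z. (v (snd z))\<^sup>2 \<partial>(P \<Otimes>\<^sub>M Q)) = (\<integral>y. (v y)\<^sup>2 \<partial>Q)"
    using v by (intro PQ.integral_comp_snd[of "\<lambda>x. (v x)\<^sup>2"]) (auto simp: square_integrable_def)
  finally show ?thesis by simp
qed

text \<open>If \<open>u(x) + v(y)\<close> is small in mean square on a box inside \<open>S\<close>, then \<open>v\<close> is nearly constant on
  the \<open>y\<close>-side of the box, since both \<open>v(y)\<close> and \<open>v(y')\<close> are close to \<open>-u(x)\<close>. Call \<open>y\<close> and \<open>y'\<close>
  related if \<open>v\<close> nearly agrees on neighborhoods of them; this is an equivalence relation with open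
  classes, because balls centered in the support have positive mass. Connectedness leaves a single class, compactness makes the constant
  uniform, and so \<open>v\<close> is nearly constant on the whole support of \<open>Q\<close>. The boxes over the
  points \<open>x\<close> then bound \<open>u(x) + v(y)\<close> for all \<open>x\<close> and \<open>y\<close>.\<close>
lemma spectral_gap:
  fixes P Q :: "'a::euclidean_space measure"
  assumes P: "prob_space P" "sets P = sets borel" "compact (topological_support P)"
    and Q: "prob_space Q" "sets Q = sets borel" "compact (topological_support Q)"
    and conn: "connected (topological_support Q)"
    and S[measurable]: "S \<in> sets (P \<Otimes>\<^sub>M Q)"
    and boxX: "\<And>x. x \<in> topological_support P \<Longrightarrow> \<exists>y\<in>topological_support Q. \<exists>r>0.
      AE z in P \<Otimes>\<^sub>M Q. z \<in> ball x r \<times> ball y r \<longrightarrow> z \<in> S"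
    and boxY: "\<And>y. y \<in> topological_support Q \<Longrightarrow> \<exists>x\<in>topological_support P. \<exists>r>0.
      AE z in P \<Otimes>\<^sub>M Q. z \<in> ball x r \<times> ball y r \<longrightarrow> z \<in> S"
  obtains \<kappa> where "0 < \<kappa>"
    and "\<And>u v. (u, v) \<in> L2sum P Q \<Longrightarrow> \<kappa> * ((\<integral>x. (u x)\<^sup>2 \<partial>P) + (\<integral>y. (v y)\<^sup>2 \<partial>Q))
      \<le> (\<integral>z. indicator S z * (u (fst z) + v (snd z))\<^sup>2 \<partial>(P \<Otimes>\<^sub>M Q))"
proof -
  interpret P: prob_space P by fact
  interpret Q: prob_space Q by fact
  interpret PQ: pair_prob_space P Q ..
  interpret QQ: pair_prob_space Q Q ..
  define \<Omega> \<Omega>' where "\<Omega> = topological_support P" and "\<Omega>' = topological_support Q"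
  define I where "I = {(u::'a \<Rightarrow> real, v::'a \<Rightarrow> real). u \<in> borel_measurable P \<and> v \<in> borel_measurable Q}"
  define E where "E i = (\<integral>\<^sup>+z. ennreal ((fst i (fst z) + snd i (snd z))\<^sup>2) * indicator S z \<partial>(P \<Otimes>\<^sub>M Q))"
    for i :: "('a \<Rightarrow> real) \<times> ('a \<Rightarrow> real)"
  have Im: "fst i \<in> borel_measurable P" "snd i \<in> borel_measurable Q"
    "(\<lambda>x. - fst i x) \<in> borel_measurable P" "(\<lambda>x. - snd i x) \<in> borel_measurable Q" if "i \<in> I" for i
    using that by (auto simp: I_def)
  have ballP: "ball x r \<in> sets P" and ballQ: "ball x r \<in> sets Q" for x :: 'a and r
    using P(2) Q(2) by auto
  have posP: "emeasure P (ball x r) \<noteq> 0" if "x \<in> \<Omega>" "0 < r" for x r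
    using that by (auto simp: \<Omega>_def topological_support_def zero_less_iff_neq_zero)
  have posQ: "emeasure Q (ball x r) \<noteq> 0" if "x \<in> \<Omega>'" "0 < r" for x r
    using that by (auto simp: \<Omega>'_def topological_support_def zero_less_iff_neq_zero)
  have \<Omega>_sets: "\<Omega> \<in> sets P" "\<Omega>' \<in> sets Q"
    unfolding \<Omega>_def \<Omega>'_def by (intro topological_support_in_sets P Q)+
  have box_le: "block_gap P Q (ball x r) (ball y r) (fst i) (\<lambda>y. - snd i y) \<le> E i"
    if "AE z in P \<Otimes>\<^sub>M Q. z \<in> ball x r \<times> ball y r \<longrightarrow> z \<in> S" for x y r i
    unfolding block_gap_def E_def
    by (rule nn_integral_mono_AE) (use that in \<open>eventually_elim, auto simp: indicator_def\<close>)
  have box_le': "block_gap P Q (ball x r) (ball y r) (\<lambda>x. - fst i x) (snd i) \<le> E i"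
    if "AE z in P \<Otimes>\<^sub>M Q. z \<in> ball x r \<times> ball y r \<longrightarrow> z \<in> S" for x y r i
  proof -
    have "(- a - b)\<^sup>2 = (a - - b)\<^sup>2" for a b :: real by (simp add: power2_eq_square algebra_simps)
    then have "block_gap P Q (ball x r) (ball y r) (\<lambda>x. - fst i x) (snd i)
      = block_gap P Q (ball x r) (ball y r) (fst i) (\<lambda>y. - snd i y)"
      unfolding block_gap_def by simp
    then show ?thesis using box_le[OF that] by simp
  qed

  \<comment> \<open>The equivalence relation of the connectedness argument; one constant serves all pairs \<open>(u, v)\<close>.\<close>
  define R where "R y y' \<longleftrightarrow> (\<exists>r>0. \<exists>C\<ge>0. \<forall>i\<in>I.
    block_gap Q Q (ball y r) (ball y' r) (snd i) (snd i) \<le> ennreal C * E i)" for y y'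
  have near: "\<exists>r>0. \<exists>C\<ge>0. \<forall>i\<in>I. block_gap Q Q (ball y r) (ball y r) (snd i) (snd i) \<le> ennreal C * E i"
    if y: "y \<in> \<Omega>'" for y
  proof -
    obtain x r where x: "x \<in> \<Omega>" "0 < r"
      and ae: "AE z in P \<Otimes>\<^sub>M Q. z \<in> ball x r \<times> ball y r \<longrightarrow> z \<in> S"
      using boxY y unfolding \<Omega>_def \<Omega>'_def by blast
    have "block_gap Q Q (ball y r) (ball y r) (snd i) (snd i) \<le> ennreal (4 / measure P (ball x r)) * E i"
      if i: "i \<in> I" for i
    proof (rule le_of_emeasure_mult_le[OF P(1) posP[OF x]])
      have "emeasure P (ball x r) * block_gap Q Q (ball y r) (ball y r) (snd i) (snd i)
        \<le> 2 * block_gap Q P (ball y r) (ball x r) (snd i) (\<lambda>x. - fst i x)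
          + 2 * block_gap P Q (ball x r) (ball y r) (\<lambda>x. - fst i x) (snd i)"
        by (intro block_gap_chain P(1) Q(1) Im[OF i] ballP ballQ)
      also have "block_gap Q P (ball y r) (ball x r) (snd i) (\<lambda>x. - fst i x)
        = block_gap P Q (ball x r) (ball y r) (\<lambda>x. - fst i x) (snd i)"
        by (intro block_gap_swap P(1) Q(1) Im[OF i] ballP ballQ)
      also have "2 * block_gap P Q (ball x r) (ball y r) (\<lambda>x. - fst i x) (snd i)
          + 2 * block_gap P Q (ball x r) (ball y r) (\<lambda>x. - fst i x) (snd i) \<le> 2 * E i + 2 * E i"
        by (intro add_mono mult_left_mono box_le'[OF ae]) auto
      also have "\<dots> = ennreal 4 * E i"
        by (simp add: distrib_right[symmetric])
      finally show "emeasure P (ball x r) * block_gap Q Q (ball y r) (ball y r) (snd i) (snd i)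
        \<le> ennreal 4 * E i" .
    qed simp
    then show ?thesis using x(2) by (intro exI[of _ r] conjI exI[of _ "4 / measure P (ball x r)"]) auto
  qed
  have R: "R y y'" if "y \<in> \<Omega>'" "y' \<in> \<Omega>'" for y y'
  proof (rule connected_equivalence_relation[OF conn[folded \<Omega>'_def] that])
    fix y y' assume "R y y'"
    then obtain r C where "0 < r" "0 \<le> C" "\<And>i. i \<in> I \<Longrightarrow>
      block_gap Q Q (ball y r) (ball y' r) (snd i) (snd i) \<le> ennreal C * E i"
      unfolding R_def by blast
    then show "R y' y" unfolding R_def
      using block_gap_swap[OF Q(1) Q(1) Im(2) Im(2) ballQ ballQ] by metis
  next
    fix y1 y2 y3 assume 12: "R y1 y2" and 23: "R y2 y3" and y2: "y2 \<in> \<Omega>'"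
    obtain r C where rC: "0 < r" "0 \<le> C" "\<And>i. i \<in> I \<Longrightarrow>
      block_gap Q Q (ball y1 r) (ball y2 r) (snd i) (snd i) \<le> ennreal C * E i"
      using 12 unfolding R_def by blast
    obtain r' C' where rC': "0 < r'" "0 \<le> C'" "\<And>i. i \<in> I \<Longrightarrow>
      block_gap Q Q (ball y2 r') (ball y3 r') (snd i) (snd i) \<le> ennreal C' * E i"
      using 23 unfolding R_def by blast
    define s where "s = min r r'"
    have s: "0 < s" and sub: "ball y s \<subseteq> ball y r" "ball y s \<subseteq> ball y r'" for y :: 'a
      using rC rC' by (auto simp: s_def)
    have "block_gap Q Q (ball y1 s) (ball y3 s) (snd i) (snd i)
      \<le> ennreal ((2 * C + 2 * C') / measure Q (ball y2 s)) * E i" if i: "i \<in> I" for i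
    proof (rule le_of_emeasure_mult_le[OF Q(1) posQ[OF y2 s]])
      have "emeasure Q (ball y2 s) * block_gap Q Q (ball y1 s) (ball y3 s) (snd i) (snd i)
        \<le> 2 * block_gap Q Q (ball y1 s) (ball y2 s) (snd i) (snd i)
          + 2 * block_gap Q Q (ball y2 s) (ball y3 s) (snd i) (snd i)"
        by (intro block_gap_chain Q(1) Im[OF i] ballQ)
      also have "\<dots> \<le> 2 * (ennreal C * E i) + 2 * (ennreal C' * E i)"
        by (intro add_mono mult_left_mono order_trans[OF block_gap_mono[OF sub(1) sub(1)] rC(3)[OF i]]
            order_trans[OF block_gap_mono[OF sub(2) sub(2)] rC'(3)[OF i]]) auto
      also have "\<dots> = ennreal (2 * C + 2 * C') * E i"
        using rC(2) rC'(2) by (simp add: ennreal_plus ennreal_mult distrib_right mult.assoc)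
      finally show "emeasure Q (ball y2 s) * block_gap Q Q (ball y1 s) (ball y3 s) (snd i) (snd i)
        \<le> ennreal (2 * C + 2 * C') * E i" .
    qed (use rC(2) rC'(2) in simp)
    then show "R y1 y3" unfolding R_def
      using s rC(2) rC'(2) by (intro exI[of _ s] conjI exI[of _ "(2 * C + 2 * C') / measure Q (ball y2 s)"]) auto
  next
    fix y assume y: "y \<in> \<Omega>'"
    obtain r C where rC: "0 < r" "0 \<le> C" "\<And>i. i \<in> I \<Longrightarrow>
      block_gap Q Q (ball y r) (ball y r) (snd i) (snd i) \<le> ennreal C * E i"
      using near[OF y] by blast
    have "R y y'" if "y' \<in> ball y (r / 2)" for y'
    proof -
      have sub: "ball y (r / 2) \<subseteq> ball y r" "ball y' (r / 2) \<subseteq> ball y r"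
        using that rC(1) dist_triangle_half_r[of y' y r] by (auto simp: dist_commute)
      then show ?thesis unfolding R_def
        using rC order_trans[OF block_gap_mono[OF sub] rC(3)] by (intro exI[of _ "r / 2"]) auto
    qed
    then show "\<exists>T. openin (top_of_set \<Omega>') T \<and> y \<in> T \<and> (\<forall>x\<in>T. R y x)"
      using y rC(1) by (intro exI[of _ "\<Omega>' \<inter> ball y (r / 2)"]) (auto simp: openin_open_Int)
  qed

  have QQ_sets: "sets (Q \<Otimes>\<^sub>M Q) = sets borel" and PQ_sets: "sets (P \<Otimes>\<^sub>M Q) = sets borel"
    using sets_pair_measure_cong[OF Q(2) Q(2)] sets_pair_measure_cong[OF P(2) Q(2)]
    unfolding borel_prod by blast+
  have "\<exists>C\<ge>0. \<forall>i\<in>I. (\<integral>\<^sup>+z. ennreal ((snd i (fst z) - snd i (snd z))\<^sup>2) * indicator (\<Omega>' \<times> \<Omega>') z \<partial>(Q \<Otimes>\<^sub>M Q))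
    \<le> ennreal C * E i"
  proof (rule compact_local_bound[OF _ QQ_sets])
    show "compact (\<Omega>' \<times> \<Omega>')" unfolding \<Omega>'_def by (intro compact_Times Q)
    show "(\<lambda>z. ennreal ((snd i (fst z) - snd i (snd z))\<^sup>2)) \<in> borel_measurable (Q \<Otimes>\<^sub>M Q)" if "i \<in> I" for i
      using Im(2)[OF that] by measurable
    fix z assume "z \<in> \<Omega>' \<times> \<Omega>'"
    then have "R (fst z) (snd z)" using R by auto
    then obtain r C where "0 < r" "0 \<le> C" "\<And>i. i \<in> I \<Longrightarrow>
      block_gap Q Q (ball (fst z) r) (ball (snd z) r) (snd i) (snd i) \<le> ennreal C * E i"
      unfolding R_def by blast
    then show "\<exists>U C. open U \<and> z \<in> U \<and> 0 \<le> C \<and> (\<forall>i\<in>I.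
      (\<integral>\<^sup>+w. ennreal ((snd i (fst w) - snd i (snd w))\<^sup>2) * indicator U w \<partial>(Q \<Otimes>\<^sub>M Q)) \<le> ennreal C * E i)"
      unfolding block_gap_def
      by (intro exI[of _ "ball (fst z) r \<times> ball (snd z) r"] exI[of _ C]) (auto intro: open_Times simp: mem_Times_iff)
  qed
  then obtain C1 where C1: "0 \<le> C1" "\<And>i. i \<in> I \<Longrightarrow> block_gap Q Q \<Omega>' \<Omega>' (snd i) (snd i) \<le> ennreal C1 * E i"
    unfolding block_gap_def by blast
  have AEQ: "AE y in Q. y \<in> \<Omega>'" and AEP: "AE x in P. x \<in> \<Omega>"
    unfolding \<Omega>_def \<Omega>'_def by (intro AE_topological_support P Q)+

  have "\<exists>C\<ge>0. \<forall>i\<in>I. (\<integral>\<^sup>+z. ennreal ((fst i (fst z) - - snd i (snd z))\<^sup>2) * indicator (\<Omega> \<times> \<Omega>') z \<partial>(P \<Otimes>\<^sub>M Q))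
    \<le> ennreal C * E i"
  proof (rule compact_local_bound[OF _ PQ_sets])
    show "compact (\<Omega> \<times> \<Omega>')" unfolding \<Omega>_def \<Omega>'_def by (intro compact_Times P Q)
    show "(\<lambda>z. ennreal ((fst i (fst z) - - snd i (snd z))\<^sup>2)) \<in> borel_measurable (P \<Otimes>\<^sub>M Q)" if "i \<in> I" for i
      using Im[OF that] by measurable
    fix z assume z: "z \<in> \<Omega> \<times> \<Omega>'"
    obtain y r where y: "y \<in> \<Omega>'" "0 < r"
      and ae: "AE w in P \<Otimes>\<^sub>M Q. w \<in> ball (fst z) r \<times> ball y r \<longrightarrow> w \<in> S"
      using boxX[of "fst z"] z unfolding \<Omega>_def \<Omega>'_def by (auto simp: mem_Times_iff)
    have "block_gap P Q (ball (fst z) r) UNIV (fst i) (\<lambda>y. - snd i y)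
      \<le> ennreal ((2 + 2 * C1) / measure Q (ball y r)) * E i" if i: "i \<in> I" for i
    proof (rule le_of_emeasure_mult_le[OF Q(1) posQ[OF y]])
      have "block_gap Q Q (ball y r) UNIV (\<lambda>y. - snd i y) (\<lambda>y. - snd i y)
        \<le> block_gap Q Q \<Omega>' \<Omega>' (snd i) (snd i)"
        unfolding block_gap_def
        by (rule nn_integral_mono_AE)
          (use QQ.AE_pair_fst[OF AEQ] QQ.AE_pair_snd[OF AEQ] in
            \<open>eventually_elim, auto simp: indicator_def mem_Times_iff power2_commute\<close>)
      also have "\<dots> \<le> ennreal C1 * E i"
        by (rule C1(2)[OF i])
      finally have Q_part: "block_gap Q Q (ball y r) UNIV (\<lambda>y. - snd i y) (\<lambda>y. - snd i y)
        \<le> ennreal C1 * E i" .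
      have "emeasure Q (ball y r) * block_gap P Q (ball (fst z) r) UNIV (fst i) (\<lambda>y. - snd i y)
        \<le> 2 * block_gap P Q (ball (fst z) r) (ball y r) (fst i) (\<lambda>y. - snd i y)
          + 2 * block_gap Q Q (ball y r) UNIV (\<lambda>y. - snd i y) (\<lambda>y. - snd i y)"
        using Q(2) by (intro block_gap_chain P(1) Q(1) Im[OF i] ballP ballQ) auto
      also have "\<dots> \<le> 2 * E i + 2 * (ennreal C1 * E i)"
        by (intro add_mono mult_left_mono box_le[OF ae] Q_part) auto
      also have "\<dots> = ennreal (2 + 2 * C1) * E i"
        using C1(1) by (simp add: ennreal_plus ennreal_mult distrib_right mult.assoc)
      finally show "emeasure Q (ball y r) * block_gap P Q (ball (fst z) r) UNIV (fst i) (\<lambda>y. - snd i y)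
        \<le> ennreal (2 + 2 * C1) * E i" .
    qed (use C1(1) in simp)
    then show "\<exists>U C. open U \<and> z \<in> U \<and> 0 \<le> C \<and> (\<forall>i\<in>I.
      (\<integral>\<^sup>+w. ennreal ((fst i (fst w) - - snd i (snd w))\<^sup>2) * indicator U w \<partial>(P \<Otimes>\<^sub>M Q)) \<le> ennreal C * E i)"
      unfolding block_gap_def using y(2) C1(1)
      by (intro exI[of _ "ball (fst z) r \<times> UNIV"] exI[of _ "(2 + 2 * C1) / measure Q (ball y r)"])
        (auto intro: open_Times simp: mem_Times_iff)
  qed
  then obtain C2 where C2: "0 \<le> C2" "\<And>i. i \<in> I \<Longrightarrow>
    (\<integral>\<^sup>+z. ennreal ((fst i (fst z) - - snd i (snd z))\<^sup>2) * indicator (\<Omega> \<times> \<Omega>') z \<partial>(P \<Otimes>\<^sub>M Q)) \<le> ennreal C2 * E i"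
    by blast
  show thesis
  proof (rule that[of "1 / (C2 + 1)"])
    show "0 < 1 / (C2 + 1)" using C2(1) by simp
    fix u v assume uv: "(u, v) \<in> L2sum P Q"
    define D where "D z = (u (fst z) + v (snd z))\<^sup>2" for z
    have u: "square_integrable P u" and v: "square_integrable Q v"
      using uv by (auto simp: L2sum_def)
    have "square_integrable (P \<Otimes>\<^sub>M Q) (\<lambda>z. u (fst z) + v (snd z))"
      by (intro square_integrable_add PQ.square_integrable_comp_fst PQ.square_integrable_comp_snd u v)
    then have D: "integrable (P \<Otimes>\<^sub>M Q) D" and D0: "\<And>z. 0 \<le> D z"
      by (auto simp: square_integrable_def D_def[abs_def])
    have DS: "integrable (P \<Otimes>\<^sub>M Q) (\<lambda>z. indicator S z * D z)"
      using integrable_mult_indicator[OF S D] by simp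
    have uvI: "(u, v) \<in> I" using u v by (auto simp: I_def square_integrable_def)
    have "ennreal (\<integral>z. D z \<partial>(P \<Otimes>\<^sub>M Q)) = (\<integral>\<^sup>+z. ennreal (D z) \<partial>(P \<Otimes>\<^sub>M Q))"
      using nn_integral_eq_integral[OF D] D0 by simp
    also have "\<dots> = (\<integral>\<^sup>+z. ennreal ((u (fst z) - - v (snd z))\<^sup>2) * indicator (\<Omega> \<times> \<Omega>') z \<partial>(P \<Otimes>\<^sub>M Q))"
      by (rule nn_integral_cong_AE)
        (use PQ.AE_pair_fst[OF AEP] PQ.AE_pair_snd[OF AEQ] in
          \<open>eventually_elim, auto simp: D_def indicator_def mem_Times_iff\<close>)
    also have "\<dots> \<le> ennreal C2 * E (u, v)" using C2(2)[OF uvI] by simp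
    also have "E (u, v) = (\<integral>\<^sup>+z. ennreal (indicator S z * D z) \<partial>(P \<Otimes>\<^sub>M Q))"
      unfolding E_def by (intro nn_integral_cong) (auto simp: D_def indicator_def)
    also have "\<dots> = ennreal (\<integral>z. indicator S z * D z \<partial>(P \<Otimes>\<^sub>M Q))"
      using nn_integral_eq_integral[OF DS] D0 by simp
    also have "ennreal C2 * \<dots> = ennreal (C2 * (\<integral>z. indicator S z * D z \<partial>(P \<Otimes>\<^sub>M Q)))"
      using C2(1) by (simp add: ennreal_mult D0)
    finally have le: "(\<integral>z. D z \<partial>(P \<Otimes>\<^sub>M Q)) \<le> C2 * (\<integral>z. indicator S z * D z \<partial>(P \<Otimes>\<^sub>M Q))"
      using C2(1) D0 by (subst (asm) ennreal_le_iff) auto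
    have E0: "0 \<le> (\<integral>z. indicator S z * D z \<partial>(P \<Otimes>\<^sub>M Q))"
      using D0 by (intro Bochner_Integration.integral_nonneg) simp
    have "(\<integral>x. (u x)\<^sup>2 \<partial>P) + (\<integral>y. (v y)\<^sup>2 \<partial>Q) \<le> (\<integral>z. D z \<partial>(P \<Otimes>\<^sub>M Q))"
      unfolding D_def integral_square_add_L2sum[OF P(1) Q(1) uv] by simp
    also have "\<dots> \<le> (C2 + 1) * (\<integral>z. indicator S z * D z \<partial>(P \<Otimes>\<^sub>M Q))"
      using le E0 unfolding distrib_right by linarith
    finally show "1 / (C2 + 1) * ((\<integral>x. (u x)\<^sup>2 \<partial>P) + (\<integral>y. (v y)\<^sup>2 \<partial>Q))
      \<le> (\<integral>z. indicator S z * (u (fst z) + v (snd z))\<^sup>2 \<partial>(P \<Otimes>\<^sub>M Q))"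
      using C2(1) by (simp add: D_def field_simps)
  qed
qed

section \<open>Regularity of the potentials\<close>

text \<open>The partial integral of \<open>\<rho>\<close> is the density of the first marginal with respect to \<open>P\<close>, hence
  equal to one by uniqueness of densities.\<close>
lemma marginal_density_fst:
  assumes "prob_space P" "prob_space Q" and \<rho>[measurable]: "\<rho> \<in> borel_measurable (P \<Otimes>\<^sub>M Q)"
    and marg: "distr (density (P \<Otimes>\<^sub>M Q) \<rho>) P fst = P"
  shows "AE x in P. (\<integral>\<^sup>+y. \<rho> (x, y) \<partial>Q) = 1"
proof -
  interpret P: prob_space P by fact
  interpret Q: prob_space Q by fact
  have dens: "density P (\<lambda>x. \<integral>\<^sup>+y. \<rho> (x, y) \<partial>Q) = P"
  proof (rule measure_eqI)
    fix A assume "A \<in> sets (density P (\<lambda>x. \<integral>\<^sup>+y. \<rho> (x, y) \<partial>Q))"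
    then have A[measurable]: "A \<in> sets P" by simp
    have "emeasure (density P (\<lambda>x. \<integral>\<^sup>+y. \<rho> (x, y) \<partial>Q)) A
      = (\<integral>\<^sup>+x. \<integral>\<^sup>+y. \<rho> (x, y) * indicator A x \<partial>Q \<partial>P)"
      by (subst emeasure_density) (auto simp: nn_integral_multc intro!: nn_integral_cong)
    also have "\<dots> = (\<integral>\<^sup>+z. \<rho> z * indicator A (fst z) \<partial>(P \<Otimes>\<^sub>M Q))"
      by (subst Q.nn_integral_fst[symmetric]) simp_all
    also have "\<dots> = (\<integral>\<^sup>+z. indicator A (fst z) \<partial>density (P \<Otimes>\<^sub>M Q) \<rho>)"
      by (simp add: nn_integral_density)
    also have "\<dots> = (\<integral>\<^sup>+x. indicator A x \<partial>distr (density (P \<Otimes>\<^sub>M Q) \<rho>) P fst)"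
      by (subst nn_integral_distr) simp_all
    finally show "emeasure (density P (\<lambda>x. \<integral>\<^sup>+y. \<rho> (x, y) \<partial>Q)) A = emeasure P A"
      by (simp add: marg)
  qed simp
  then have "density P (\<lambda>x. \<integral>\<^sup>+y. \<rho> (x, y) \<partial>Q) = density P (\<lambda>_. 1)"
    by (simp add: density_1)
  then show ?thesis
    by (subst (asm) sigma_finite_density_unique)
      (auto simp: dens P.sigma_finite_measure_axioms)
qed

lemma marginal_density_snd:
  assumes "prob_space P" "prob_space Q" and \<rho>[measurable]: "\<rho> \<in> borel_measurable (P \<Otimes>\<^sub>M Q)"
    and marg: "distr (density (P \<Otimes>\<^sub>M Q) \<rho>) Q snd = Q"
  shows "AE y in Q. (\<integral>\<^sup>+x. \<rho> (x, y) \<partial>P) = 1"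
proof -
  interpret P: prob_space P by fact
  interpret Q: prob_space Q by fact
  interpret PQ: pair_prob_space P Q ..
  have dens: "density Q (\<lambda>y. \<integral>\<^sup>+x. \<rho> (x, y) \<partial>P) = Q"
  proof (rule measure_eqI)
    fix A assume "A \<in> sets (density Q (\<lambda>y. \<integral>\<^sup>+x. \<rho> (x, y) \<partial>P))"
    then have A[measurable]: "A \<in> sets Q" by simp
    have "emeasure (density Q (\<lambda>y. \<integral>\<^sup>+x. \<rho> (x, y) \<partial>P)) A
      = (\<integral>\<^sup>+y. \<integral>\<^sup>+x. \<rho> (x, y) * indicator A y \<partial>P \<partial>Q)"
      by (subst emeasure_density) (auto simp: nn_integral_multc intro!: nn_integral_cong)
    also have "\<dots> = (\<integral>\<^sup>+z. \<rho> z * indicator A (snd z) \<partial>(P \<Otimes>\<^sub>M Q))"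
      by (subst PQ.nn_integral_snd[symmetric]) simp_all
    also have "\<dots> = (\<integral>\<^sup>+z. indicator A (snd z) \<partial>density (P \<Otimes>\<^sub>M Q) \<rho>)"
      by (simp add: nn_integral_density)
    also have "\<dots> = (\<integral>\<^sup>+x. indicator A x \<partial>distr (density (P \<Otimes>\<^sub>M Q) \<rho>) Q snd)"
      by (subst nn_integral_distr) simp_all
    finally show "emeasure (density Q (\<lambda>y. \<integral>\<^sup>+x. \<rho> (x, y) \<partial>P)) A = emeasure Q A"
      by (simp add: marg)
  qed simp
  then have "density Q (\<lambda>y. \<integral>\<^sup>+x. \<rho> (x, y) \<partial>P) = density Q (\<lambda>_. 1)"
    by (simp add: density_1)
  then show ?thesis
    by (subst (asm) sigma_finite_density_unique)
      (auto simp: dens Q.sigma_finite_measure_axioms)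
qed

lemma qot_excess_swap: "qot_excess g f y x = qot_excess f g x y"
  by (simp add: qot_excess_def norm_minus_commute add.commute)

lemma qot_excess_nonneg: "0 \<le> qot_excess f g x y"
  by (simp add: qot_excess_def)

lemma qot_excess_measurable:
  fixes P Q :: "'a::euclidean_space measure"
  assumes [measurable_cong]: "sets P = sets borel" "sets Q = sets borel"
    and [measurable]: "f \<in> borel_measurable P" "g \<in> borel_measurable Q"
  shows "(\<lambda>z. qot_excess f g (fst z) (snd z)) \<in> borel_measurable (P \<Otimes>\<^sub>M Q)"
  unfolding qot_excess_def by measurable

lemma qot_excess_measurable_snd:
  fixes Q :: "'a::euclidean_space measure"
  assumes [measurable_cong]: "sets Q = sets borel" and [measurable]: "g \<in> borel_measurable Q"
  shows "qot_excess f g x \<in> borel_measurable Q"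
  unfolding qot_excess_def[abs_def] by measurable

text \<open>The points of the support at which the first order condition for the potentials holds.
  The potentials are only defined up to null sets; a pointwise condition singles out
  the points where their values are meaningful. Swapping the roles of the two marginals gives
  the corresponding notion for \<open>g\<close>.\<close>
definition marginal_point where
  "marginal_point \<epsilon> P Q f g x \<longleftrightarrow>
    x \<in> topological_support P \<and> (\<integral>y. qot_excess f g x y \<partial>Q) = \<epsilon>"

text \<open>The excess divided by \<open>\<epsilon>\<close> is the density of a coupling, so both of its partial integrals are
  one.\<close>
lemma AE_marginal_point:
  fixes P Q :: "'a::euclidean_space measure"
  assumes \<epsilon>: "0 < \<epsilon>" and P: "prob_space P" "sets P = sets borel"
    and Q: "prob_space Q" "sets Q = sets borel"
    and pot: "qot_potentials \<epsilon> P Q (f, g)"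
  shows "AE x in P. marginal_point \<epsilon> P Q f g x"
    and "AE y in Q. marginal_point \<epsilon> Q P g f y"
proof -
  interpret P: prob_space P by fact
  interpret Q: prob_space Q by fact
  interpret PQ: pair_prob_space P Q ..
  have f[measurable]: "f \<in> borel_measurable P" and g[measurable]: "g \<in> borel_measurable Q"
    using pot by (auto simp: qot_potentials_def L2sum_def square_integrable_def)
  note [measurable] = qot_excess_measurable[OF P(2) Q(2) f g] qot_excess_measurable_snd[OF Q(2) g]
    qot_excess_measurable_snd[OF P(2) f]
  obtain \<pi> where \<pi>: "\<pi> \<in> couplings P Q" "absolutely_continuous (P \<Otimes>\<^sub>M Q) \<pi>"
    and RN: "AE (x, y) in P \<Otimes>\<^sub>M Q. RN_deriv (P \<Otimes>\<^sub>M Q) \<pi> (x, y) = ennreal (1 / \<epsilon> * qot_excess f g x y)"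
    using pot by (auto simp: qot_potentials_def qot_optimal_def)
  define \<rho> where "\<rho> z = ennreal (1 / \<epsilon> * qot_excess f g (fst z) (snd z))" for z
  have [measurable]: "\<rho> \<in> borel_measurable (P \<Otimes>\<^sub>M Q)" unfolding \<rho>_def by measurable
  have "\<pi> = density (P \<Otimes>\<^sub>M Q) (RN_deriv (P \<Otimes>\<^sub>M Q) \<pi>)"
    using \<pi> by (intro PQ.density_RN_deriv[symmetric]) (auto simp: couplings_def)
  also have "\<dots> = density (P \<Otimes>\<^sub>M Q) \<rho>"
    by (rule density_cong) (use RN in \<open>auto simp: \<rho>_def case_prod_unfold\<close>)
  finally have \<pi>_eq: "\<pi> = density (P \<Otimes>\<^sub>M Q) \<rho>" .
  have "distr \<pi> borel fst = distr \<pi> P fst" "distr \<pi> borel snd = distr \<pi> Q snd"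
    using P(2) Q(2) by (auto intro: distr_cong)
  then have "distr (density (P \<Otimes>\<^sub>M Q) \<rho>) P fst = P" "distr (density (P \<Otimes>\<^sub>M Q) \<rho>) Q snd = Q"
    using \<pi>(1) by (auto simp: \<pi>_eq couplings_def)
  note mass = marginal_density_fst[OF P(1) Q(1) _ this(1)] marginal_density_snd[OF P(1) Q(1) _ this(2)]
  have integral: "integral\<^sup>L M k = \<epsilon>"
    if [measurable]: "k \<in> borel_measurable M" and k: "\<And>y. 0 \<le> k y" "(\<integral>\<^sup>+y. ennreal (1 / \<epsilon> * k y) \<partial>M) = 1"
    for M and k :: "'a \<Rightarrow> real"
  proof -
    have "(\<integral>y. 1 / \<epsilon> * k y \<partial>M) = enn2real (\<integral>\<^sup>+y. ennreal (1 / \<epsilon> * k y) \<partial>M)"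
      using \<epsilon> k(1) by (intro integral_eq_nn_integral) (auto simp: zero_le_divide_iff)
    then show ?thesis using \<epsilon> unfolding k(2) by simp
  qed
  show "AE x in P. marginal_point \<epsilon> P Q f g x"
    using mass(1)[OF \<open>\<rho> \<in> _\<close>] AE_topological_support[OF P(2)]
  proof eventually_elim
    case (elim x)
    then show ?case unfolding marginal_point_def
      by (intro conjI integral) (simp_all add: \<rho>_def qot_excess_nonneg)
  qed
  show "AE y in Q. marginal_point \<epsilon> Q P g f y"
    using mass(2)[OF \<open>\<rho> \<in> _\<close>] AE_topological_support[OF Q(2)]
  proof eventually_elim
    case (elim y)
    then show ?case unfolding marginal_point_def
      by (intro conjI integral) (simp_all add: \<rho>_def qot_excess_nonneg qot_excess_swap[of g f])
  qed
qed

lemma half_sq_dist_diff_le: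
  fixes x x' y :: "'a::real_normed_vector"
  assumes "norm (x - y) \<le> D" "norm (x' - y) \<le> D"
  shows "\<bar>(norm (x - y))\<^sup>2 / 2 - (norm (x' - y))\<^sup>2 / 2\<bar> \<le> D * norm (x - x')"
proof -
  have "\<bar>norm (x - y) - norm (x' - y)\<bar> \<le> norm (x - x')"
    using norm_triangle_ineq3[of "x - y" "x' - y"] by simp
  then have "\<bar>norm (x - y) - norm (x' - y)\<bar> * (norm (x - y) + norm (x' - y)) \<le> norm (x - x') * (D + D)"
    using assms by (intro mult_mono) auto
  moreover have "\<bar>(norm (x - y))\<^sup>2 - (norm (x' - y))\<^sup>2\<bar>
    = \<bar>norm (x - y) - norm (x' - y)\<bar> * (norm (x - y) + norm (x' - y))"
    by (simp add: power2_eq_square square_diff_square_factored abs_mult mult.commute)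
  ultimately show ?thesis by (simp add: diff_divide_distrib[symmetric] mult.commute mult.left_commute)
qed

text \<open>If \<open>f\<close> increased from \<open>x\<close> to \<open>x'\<close> by more than the oscillation of the cost, then the excess at
  \<open>x'\<close> would be strictly larger wherever the excess at \<open>x\<close> is positive, and so would
  its integral; but both integrals are \<open>\<epsilon> > 0\<close>. Exchanging \<open>x\<close> and \<open>x'\<close> gives a Lipschitz bound
  on the set of points where the first order condition holds.\<close>
lemma potential_le:
  fixes Q :: "'a::euclidean_space measure"
  assumes \<epsilon>: "0 < \<epsilon>" and Q: "sets Q = sets borel" and g: "g \<in> borel_measurable Q"
    and D: "\<And>y. y \<in> topological_support Q \<Longrightarrow> norm (x - y) \<le> D"
      "\<And>y. y \<in> topological_support Q \<Longrightarrow> norm (x' - y) \<le> D"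
    and x: "(\<integral>y. qot_excess f g x y \<partial>Q) = \<epsilon>" and x': "(\<integral>y. qot_excess f g x' y \<partial>Q) = \<epsilon>"
  shows "f x' \<le> f x + D * norm (x - x')"
proof (rule ccontr)
  assume "\<not> ?thesis"
  then have gap: "f x + D * norm (x - x') < f x'" by simp
  have int: "integrable Q (qot_excess f g x)" "integrable Q (qot_excess f g x')"
    using x x' \<epsilon> not_integrable_integral_eq[of Q "qot_excess f g x"]
      not_integrable_integral_eq[of Q "qot_excess f g x'"] by auto
  have less: "AE y in Q. f x + g y - (norm (x - y))\<^sup>2 / 2 < f x' + g y - (norm (x' - y))\<^sup>2 / 2"
    using AE_topological_support[OF Q]
  proof eventually_elim
    case (elim y)
    then show ?case
      using half_sq_dist_diff_le[OF D(1)[OF elim] D(2)[OF elim]] gap by linarith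
  qed
  then have "AE y in Q. 0 \<le> qot_excess f g x' y - qot_excess f g x y"
    by eventually_elim (auto simp: qot_excess_def)
  moreover have "(\<integral>y. qot_excess f g x' y - qot_excess f g x y \<partial>Q) = 0"
    using int x x' by simp
  ultimately have "AE y in Q. qot_excess f g x' y - qot_excess f g x y = 0"
    using int by (subst (asm) integral_nonneg_eq_0_iff_AE) auto
  with less have "AE y in Q. qot_excess f g x y = 0"
    by eventually_elim (auto simp: qot_excess_def max_def split: if_splits)
  then have "(\<integral>y. qot_excess f g x y \<partial>Q) = 0"
    by (rule integral_eq_zero_AE)
  then show False using x \<epsilon> by simp
qed

text \<open>The excess has mean \<open>\<epsilon>\<close> over \<open>y\<close>, so it is at least \<open>\<epsilon>\<close> at some \<open>y\<close>. By the Lipschitz bounds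
  it stays above \<open>\<epsilon>/2\<close> at all points of a box at which the first order conditions hold; these
  have full measure.\<close>
lemma positive_excess_box:
  fixes P Q :: "'a::euclidean_space measure"
  assumes \<epsilon>: "0 < \<epsilon>" and P: "prob_space P" "sets P = sets borel"
    and Q: "prob_space Q" "sets Q = sets borel"
    and f: "f \<in> borel_measurable P" and g: "g \<in> borel_measurable Q"
    and D: "\<And>x y. x \<in> topological_support P \<Longrightarrow> y \<in> topological_support Q \<Longrightarrow> norm (x - y) \<le> D"
    and mp: "AE x in P. marginal_point \<epsilon> P Q f g x" "AE y in Q. marginal_point \<epsilon> Q P g f y"
    and x: "x \<in> topological_support P"
  obtains y r where "y \<in> topological_support Q" "0 < r"
    "\<And>x1 y1. \<lbrakk>x1 \<in> ball x r; y1 \<in> ball y r; marginal_point \<epsilon> P Q f g x1; marginal_point \<epsilon> Q P g f y1\<rbrakk>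
      \<Longrightarrow> \<epsilon> / 2 \<le> f x1 + g y1 - (norm (x1 - y1))\<^sup>2 / 2"
proof -
  interpret Q: prob_space Q by fact
  define L where "L = max D 1"
  have L: "0 < L" "D \<le> L" by (auto simp: L_def)
  \<comment> \<open>The excess may drop by at most \<open>6Lr\<close> on the box: twice \<open>2Lr\<close> for the change of \<open>x\<close> (in \<open>f\<close>
    and in the cost) and twice \<open>Lr\<close> for the change of \<open>y\<close>.\<close>
  define r where "r = \<epsilon> / (12 * L)"
  have r: "0 < r" "L * r = \<epsilon> / 12" using L \<epsilon> by (auto simp: r_def)
  obtain x0 where x0: "x0 \<in> ball x r" "marginal_point \<epsilon> P Q f g x0"
    using AE_topological_support_obtain[OF P(2) mp(1), of "ball x r" x] x r by auto
  have x0': "x0 \<in> topological_support P" "(\<integral>y. qot_excess f g x0 y \<partial>Q) = \<epsilon>"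
    using x0(2) by (auto simp: marginal_point_def)
  have int: "integrable Q (qot_excess f g x0)"
    using x0' \<epsilon> not_integrable_integral_eq[of Q "qot_excess f g x0"] by auto
  have "\<not> (AE y in Q. qot_excess f g x0 y < \<epsilon>)"
    using Q.expectation_less[OF int] x0'(2) by auto
  moreover have "AE y in Q. qot_excess f g x0 y < \<epsilon>"
    if "AE y in Q. \<not> (marginal_point \<epsilon> Q P g f y \<and> \<epsilon> \<le> qot_excess f g x0 y)"
    using that mp(2) by eventually_elim auto
  ultimately have "\<not> (AE y in Q. \<not> (marginal_point \<epsilon> Q P g f y \<and> \<epsilon> \<le> qot_excess f g x0 y))"
    by blast
  then obtain y where y: "marginal_point \<epsilon> Q P g f y" "\<epsilon> \<le> qot_excess f g x0 y"
    by (metis (mono_tags, lifting) AE_I2)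
  have y': "y \<in> topological_support Q" "(\<integral>x. qot_excess g f y x \<partial>P) = \<epsilon>"
    using y(1) by (auto simp: marginal_point_def)
  have base: "\<epsilon> \<le> f x0 + g y - (norm (x0 - y))\<^sup>2 / 2"
    using y(2) \<epsilon> by (auto simp: qot_excess_def max_def split: if_splits)
  show thesis
  proof (rule that[OF y'(1) r(1)])
    fix x1 y1 assume b: "x1 \<in> ball x r" "y1 \<in> ball y r"
      and m: "marginal_point \<epsilon> P Q f g x1" "marginal_point \<epsilon> Q P g f y1"
    have m1: "x1 \<in> topological_support P" "(\<integral>y. qot_excess f g x1 y \<partial>Q) = \<epsilon>"
      "y1 \<in> topological_support Q" "(\<integral>x. qot_excess g f y1 x \<partial>P) = \<epsilon>"
      using m by (auto simp: marginal_point_def)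
    have D0: "0 \<le> D" using D[OF x0'(1) y'(1)] norm_ge_zero order_trans by blast
    have dx: "D * norm (x1 - x0) \<le> \<epsilon> / 6"
    proof -
      have "norm (x1 - x0) \<le> 2 * r"
        using x0(1) b(1) dist_triangle[of x1 x0 x] by (auto simp: dist_norm[symmetric] dist_commute)
      then have "D * norm (x1 - x0) \<le> L * (2 * r)" using L D0 by (intro mult_mono) auto
      then show ?thesis using r(2) by simp
    qed
    have dy: "D * norm (y1 - y) \<le> \<epsilon> / 12"
    proof -
      have "norm (y1 - y) \<le> r"
        using b(2) by (auto simp: dist_norm norm_minus_commute)
      then have "D * norm (y1 - y) \<le> L * r" using L D0 by (intro mult_mono) auto
      then show ?thesis using r(2) by simp
    qed
    have "f x0 \<le> f x1 + D * norm (x1 - x0)"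
      by (rule potential_le[OF \<epsilon> Q(2) g]) (use D x0' m1 in auto)
    moreover have "g y \<le> g y1 + D * norm (y1 - y)"
      by (rule potential_le[OF \<epsilon> P(2) f]) (use D y' m1 in \<open>auto simp: norm_minus_commute\<close>)
    moreover have "\<bar>(norm (x1 - y1))\<^sup>2 / 2 - (norm (x0 - y1))\<^sup>2 / 2\<bar> \<le> D * norm (x1 - x0)"
      by (intro half_sq_dist_diff_le D m1 x0')
    moreover have "\<bar>(norm (y1 - x0))\<^sup>2 / 2 - (norm (y - x0))\<^sup>2 / 2\<bar> \<le> D * norm (y1 - y)"
      by (intro half_sq_dist_diff_le) (use D m1 x0' y' in \<open>auto simp: norm_minus_commute\<close>)
    ultimately show "\<epsilon> / 2 \<le> f x1 + g y1 - (norm (x1 - y1))\<^sup>2 / 2"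
      using base dx dy by (simp add: norm_minus_commute[of _ x0])
  qed
qed

section \<open>Uniform bounds on the iterates\<close>

lemma qot_excess_integral:
  fixes f g :: "'a::euclidean_space \<Rightarrow> real"
  assumes M: "prob_space M" "sets M = sets borel" and g: "g \<in> borel_measurable M" and B: "\<And>y. \<bar>g y\<bar> \<le> B"
  shows "integrable M (qot_excess f g x)"
    and "(\<integral>y. qot_excess f g x y \<partial>M) \<le> \<bar>f x\<bar> + B"
proof -
  interpret prob_space M by (rule M(1))
  have B0: "0 \<le> B" using B[of undefined] by linarith
  have le: "qot_excess f g x y \<le> \<bar>f x\<bar> + B" for y
    using B[of y] B0 by (simp add: qot_excess_def abs_le_iff) (smt (verit) zero_le_power2 divide_nonneg_pos)
  show int: "integrable M (qot_excess f g x)"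
    using qot_excess_measurable_snd[OF M(2) g] le qot_excess_nonneg[of f g x]
    by (intro integrable_const_bound[where B = "\<bar>f x\<bar> + B"]) auto
  show "(\<integral>y. qot_excess f g x y \<partial>M) \<le> \<bar>f x\<bar> + B"
    using integral_mono[OF int integrable_const le] by (simp add: prob_space)
qed

text \<open>By Jensen's inequality the integral of the excess is at least \<open>f(x) + m - K\<close>. The new value is
  thus bounded by a convex combination of \<open>f(x)\<close> and \<open>\<epsilon> + K - m\<close>, and an upper bound that
  dominates both is inherited.\<close>
lemma gd_step_le:
  fixes f g :: "'a::euclidean_space \<Rightarrow> real"
  assumes M: "prob_space M" "sets M = sets borel" and g: "g \<in> borel_measurable M" and B: "\<And>y. \<bar>g y\<bar> \<le> B"
    and K: "AE y in M. (norm (x - y))\<^sup>2 / 2 \<le> K" and m: "m \<le> (\<integral>y. g y \<partial>M)"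
    and \<eta>: "0 < \<eta>" "\<eta> < \<epsilon>" and U: "f x \<le> U" "\<epsilon> + K - m \<le> U"
  shows "f x + \<eta> * (1 - 1 / \<epsilon> * (\<integral>y. qot_excess f g x y \<partial>M)) \<le> U"
proof -
  interpret prob_space M by (rule M(1))
  have ig: "integrable M g"
    using g B by (intro integrable_const_bound[where B = B]) auto
  have le: "AE y in M. f x + g y - K \<le> qot_excess f g x y"
    using K by eventually_elim (simp add: qot_excess_def)
  have "f x + m - K \<le> f x + (\<integral>y. g y \<partial>M) - K" using m by simp
  also have "\<dots> = (\<integral>y. f x + g y - K \<partial>M)"
    using ig by (simp add: prob_space)
  also have "\<dots> \<le> (\<integral>y. qot_excess f g x y \<partial>M)"
    using ig qot_excess_integral(1)[OF M g B] by (intro integral_mono_AE le) auto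
  finally have I: "f x + m - K \<le> (\<integral>y. qot_excess f g x y \<partial>M)" .
  define t where "t = \<eta> / \<epsilon>"
  have t: "0 < t" "t < 1" "\<eta> = t * \<epsilon>" using \<eta> by (auto simp: t_def)
  have "f x + \<eta> * (1 - 1 / \<epsilon> * (\<integral>y. qot_excess f g x y \<partial>M))
    = f x + t * (\<epsilon> - (\<integral>y. qot_excess f g x y \<partial>M))"
    using \<eta> by (simp add: t_def field_simps)
  also have "\<dots> \<le> f x + t * (\<epsilon> - (f x + m - K))"
    using I t by (intro add_left_mono mult_left_mono) auto
  also have "\<dots> = (1 - t) * f x + t * (\<epsilon> + K - m)" by (simp add: algebra_simps)
  also have "\<dots> \<le> (1 - t) * U + t * U"
    using U t by (intro add_mono mult_left_mono) auto
  also have "\<dots> = U" by (simp add: algebra_simps)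
  finally show ?thesis .
qed

text \<open>If \<open>g \<le> V\<close>, the excess at a point with \<open>f(x) \<ge> -V\<close> is at most \<open>f(x) + V\<close>. As \<open>\<eta> < \<epsilon>\<close>, the
  step cannot overshoot the level \<open>-V\<close>.\<close>
lemma gd_step_ge:
  fixes f g :: "'a::euclidean_space \<Rightarrow> real"
  assumes M: "prob_space M" "sets M = sets borel" and g: "g \<in> borel_measurable M" and B: "\<And>y. \<bar>g y\<bar> \<le> B"
    and V: "AE y in M. g y \<le> V" "- V \<le> f x" and \<eta>: "0 < \<eta>" "\<eta> < \<epsilon>"
  shows "- V \<le> f x + \<eta> * (1 - 1 / \<epsilon> * (\<integral>y. qot_excess f g x y \<partial>M))"
proof -
  interpret prob_space M by (rule M(1))
  have "qot_excess f g x y \<le> f x + V" if "g y \<le> V" for y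
  proof -
    have "0 \<le> (norm (x - y))\<^sup>2 / 2" by simp
    then show ?thesis using that V(2) unfolding qot_excess_def by linarith
  qed
  then have "(\<integral>y. qot_excess f g x y \<partial>M) \<le> (\<integral>y. f x + V \<partial>M)"
    using V(1) qot_excess_integral(1)[OF M g B]
    by (intro integral_mono_AE) (auto elim!: eventually_mono)
  then have I: "(\<integral>y. qot_excess f g x y \<partial>M) \<le> f x + V" by (simp add: prob_space)
  define t where "t = \<eta> / \<epsilon>"
  have t: "0 < t" "t < 1" "\<eta> = t * \<epsilon>" using \<eta> by (auto simp: t_def)
  have "- V \<le> (1 - t) * (f x + V) - V" using t V(2) by simp
  also have "\<dots> \<le> (1 - t) * (f x + V) - V + t * \<epsilon>" using t \<eta> by simp
  also have "\<dots> = f x + t * (\<epsilon> - (f x + V))" by (simp add: algebra_simps)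
  also have "\<dots> \<le> f x + t * (\<epsilon> - (\<integral>y. qot_excess f g x y \<partial>M))"
    using I t by (intro add_left_mono mult_left_mono) auto
  also have "\<dots> = f x + \<eta> * (1 - 1 / \<epsilon> * (\<integral>y. qot_excess f g x y \<partial>M))"
    using \<eta> by (simp add: t_def field_simps)
  finally show ?thesis .
qed

lemma qot_excess_integral_measurable:
  fixes P Q :: "'a::euclidean_space measure"
  assumes "sets P = sets borel" "prob_space Q" "sets Q = sets borel"
    and "f \<in> borel_measurable P" "g \<in> borel_measurable Q"
  shows "(\<lambda>x. \<integral>y. qot_excess f g x y \<partial>Q) \<in> borel_measurable P"
proof -
  interpret Q: prob_space Q by fact
  have [measurable]: "(\<lambda>(x, y). qot_excess f g x y) \<in> borel_measurable (P \<Otimes>\<^sub>M Q)"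
    using qot_excess_measurable[OF assms(1,3,4,5)] by (simp add: case_prod_unfold)
  show ?thesis by measurable
qed

text \<open>The bound may depend on \<open>n\<close>; it makes the integrals finite. A bound that is uniform in \<open>n\<close> needs
  the descent of the error.\<close>
lemma gd_iter_measurable_bounded:
  fixes P Q :: "'a::euclidean_space measure"
  assumes P: "prob_space P" "sets P = sets borel" and Q: "prob_space Q" "sets Q = sets borel"
    and cP: "compact (topological_support P)" and cQ: "compact (topological_support Q)"
    and f0: "continuous_on (topological_support P) f0" and g0: "continuous_on (topological_support Q) g0"
    and \<eta>: "0 < \<eta>" "\<eta> < \<epsilon>"
  defines "it \<equiv> gd_iter \<epsilon> \<eta> P Q f0 g0"
  shows "fst (it n) \<in> borel_measurable P \<and> snd (it n) \<in> borel_measurable Q \<and>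
    (\<exists>B. \<forall>x. \<bar>fst (it n) x\<bar> \<le> B \<and> \<bar>snd (it n) x\<bar> \<le> B)"
proof (induction n)
  case 0
  have meas: "(\<lambda>x. if x \<in> topological_support M then h x else 0) \<in> borel_measurable M"
    if "sets M = sets borel" "continuous_on (topological_support M) h" for M :: "'a measure" and h :: "'a \<Rightarrow> real"
  proof -
    have "(\<lambda>x. if x \<in> topological_support M then h x else 0) \<in> borel_measurable borel"
      using that topological_support_in_sets[OF that(1)]
      by (intro borel_measurable_continuous_on_if) auto
    then show ?thesis using that(1) measurable_cong_sets by blast
  qed
  obtain B1 where B1: "\<And>x. x \<in> topological_support P \<Longrightarrow> \<bar>f0 x\<bar> \<le> B1"
    using compact_imp_bounded[OF compact_continuous_image[OF f0 cP]] by (auto simp: bounded_iff)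
  obtain B2 where B2: "\<And>x. x \<in> topological_support Q \<Longrightarrow> \<bar>g0 x\<bar> \<le> B2"
    using compact_imp_bounded[OF compact_continuous_image[OF g0 cQ]] by (auto simp: bounded_iff)
  have "\<bar>fst (it 0) x\<bar> \<le> \<bar>B1\<bar> + \<bar>B2\<bar> \<and> \<bar>snd (it 0) x\<bar> \<le> \<bar>B1\<bar> + \<bar>B2\<bar>" for x
    using B1[of x] B2[of x] by (auto simp: it_def)
  moreover have "fst (it 0) \<in> borel_measurable P" "snd (it 0) \<in> borel_measurable Q"
    using meas[OF P(2) f0] meas[OF Q(2) g0] by (simp_all add: it_def)
  ultimately show ?case by blast
next
  case (Suc n)
  interpret P: prob_space P by fact
  interpret Q: prob_space Q by fact
  obtain f g where fg: "it n = (f, g)" by fastforce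
  obtain B where f[measurable]: "f \<in> borel_measurable P" and g[measurable]: "g \<in> borel_measurable Q"
    and B: "\<And>x. \<bar>f x\<bar> \<le> B" "\<And>x. \<bar>g x\<bar> \<le> B"
    using Suc fg by auto
  define f' g' where
    "f' = (\<lambda>x. if x \<in> topological_support P
             then f x + \<eta> * (1 - 1 / \<epsilon> * (\<integral>y. qot_excess f g x y \<partial>Q)) else 0)" and
    "g' = (\<lambda>y. if y \<in> topological_support Q
             then g y + \<eta> * (1 - 1 / \<epsilon> * (\<integral>x. qot_excess f g x y \<partial>P)) else 0)"
  have it': "it (Suc n) = (f', g')"
    using fg by (simp add: it_def f'_def g'_def)
  have [measurable]: "topological_support P \<in> sets P" "topological_support Q \<in> sets Q"
    by (intro topological_support_in_sets P Q)+
  have [measurable]: "(\<lambda>y. \<integral>x. qot_excess f g x y \<partial>P) \<in> borel_measurable Q"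
    using qot_excess_integral_measurable[OF Q(2) P g f] by (simp add: qot_excess_swap)
  note [measurable] = qot_excess_integral_measurable[OF P(2) Q f g]
  have m: "f' \<in> borel_measurable P" "g' \<in> borel_measurable Q"
    unfolding f'_def g'_def by measurable
  have "0 \<le> B" using B(1)[of undefined] by linarith
  have est: "\<bar>s + \<eta> * (1 - 1 / \<epsilon> * I)\<bar> \<le> B + \<eta> * (1 + 1 / \<epsilon> * (2 * B))"
    if "\<bar>s\<bar> \<le> B" "0 \<le> I" "I \<le> 2 * B" for s I
  proof -
    have "0 \<le> 1 / \<epsilon> * I" "1 / \<epsilon> * I \<le> 1 / \<epsilon> * (2 * B)"
      using that \<eta> by (auto intro!: divide_right_mono)
    then have "\<bar>1 - 1 / \<epsilon> * I\<bar> \<le> 1 + 1 / \<epsilon> * (2 * B)" by linarith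
    then have "\<bar>\<eta> * (1 - 1 / \<epsilon> * I)\<bar> \<le> \<eta> * (1 + 1 / \<epsilon> * (2 * B))"
      unfolding abs_mult using \<eta> by (intro mult_mono) auto
    then show ?thesis using that(1) by linarith
  qed
  have "(\<integral>y. qot_excess f g x y \<partial>Q) \<le> 2 * B" for x
    using qot_excess_integral(2)[OF Q g B(2), of f x] B(1)[of x] by linarith
  moreover have "(\<integral>x. qot_excess f g x y \<partial>P) \<le> 2 * B" for y
    using qot_excess_integral(2)[OF P f B(1), of g y] B(2)[of y] by (simp add: qot_excess_swap[of g])
  moreover have "0 \<le> B + \<eta> * (1 + 1 / \<epsilon> * (2 * B))" using \<open>0 \<le> B\<close> \<eta> by simp
  ultimately have "\<bar>f' x\<bar> \<le> B + \<eta> * (1 + 1 / \<epsilon> * (2 * B)) \<and> \<bar>g' x\<bar> \<le> B + \<eta> * (1 + 1 / \<epsilon> * (2 * B))" for x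
    unfolding f'_def g'_def using B
    by (auto intro!: est Bochner_Integration.integral_nonneg qot_excess_nonneg simp del: mult_1 times_divide_eq_left)
  then show ?case using m by (auto simp: it')
qed

section \<open>Linear convergence\<close>

lemma L2sum_cong_AE:
  assumes "AE x in P. u x = u' x" "AE y in Q. v y = v' y"
    and m[measurable]: "u \<in> borel_measurable P" "v \<in> borel_measurable Q"
    and uv: "(u', v') \<in> L2sum P Q"
  shows "(u, v) \<in> L2sum P Q"
    and "(\<integral>x. (u x)\<^sup>2 \<partial>P) = (\<integral>x. (u' x)\<^sup>2 \<partial>P)" "(\<integral>y. (v y)\<^sup>2 \<partial>Q) = (\<integral>y. (v' y)\<^sup>2 \<partial>Q)"
proof -
  have [measurable]: "u' \<in> borel_measurable P" "v' \<in> borel_measurable Q"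
    and i: "integrable P (\<lambda>x. (u' x)\<^sup>2)" "integrable Q (\<lambda>x. (v' x)\<^sup>2)"
    and eq: "integral\<^sup>L P u' = integral\<^sup>L Q v'"
    using uv by (auto simp: L2sum_def square_integrable_def)
  have ae: "AE x in P. (u x)\<^sup>2 = (u' x)\<^sup>2" "AE y in Q. (v y)\<^sup>2 = (v' y)\<^sup>2"
    using assms(1,2) by (auto elim!: eventually_mono)
  show "(\<integral>x. (u x)\<^sup>2 \<partial>P) = (\<integral>x. (u' x)\<^sup>2 \<partial>P)" "(\<integral>y. (v y)\<^sup>2 \<partial>Q) = (\<integral>y. (v' y)\<^sup>2 \<partial>Q)"
    by (intro integral_cong_AE ae; measurable)+
  have "integrable P (\<lambda>x. (u x)\<^sup>2)" "integrable Q (\<lambda>x. (v x)\<^sup>2)"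
    using i ae by (auto intro: integrable_cong_AE_imp elim!: eventually_mono)
  moreover have "integral\<^sup>L P u = integral\<^sup>L Q v"
    using integral_cong_AE[OF _ _ assms(1)] integral_cong_AE[OF _ _ assms(2)] eq by simp
  ultimately show "(u, v) \<in> L2sum P Q"
    using m by (auto simp: L2sum_def square_integrable_def)
qed

lemma pos_part_monotone: "((max 0 a :: real) - max 0 b)\<^sup>2 \<le> (max 0 a - max 0 b) * (a - b)"
proof (cases "0 \<le> a \<longleftrightarrow> 0 \<le> b")
  case True then show ?thesis by (auto simp: power2_eq_square max_def)
next
  case False
  then consider "0 \<le> a" "b < 0" | "a < 0" "0 \<le> b" by linarith
  then show ?thesis
  proof cases
    case 1
    then have "a * a \<le> a * (a - b)" by (intro mult_left_mono) auto
    then show ?thesis using 1 by (simp add: power2_eq_square max_def)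
  next
    case 2
    then have "b * b \<le> b * (b - a)" by (intro mult_left_mono) auto
    then show ?thesis using 2 by (simp add: power2_eq_square max_def algebra_simps)
  qed
qed

text \<open>The positive part is not strongly monotone, but it becomes so if one argument is bounded away
  from zero and the other is bounded below. The worst case is that of \<open>b = \<delta>\<close> and \<open>a = -m\<close>, where
  the difference quotient is \<open>\<delta> / (\<delta> + m)\<close>.\<close>
lemma pos_part_strongly_monotone:
  fixes a b \<delta> m :: real
  assumes "0 < \<delta>" "\<delta> \<le> b" "0 \<le> m" "- m \<le> a"
  shows "\<delta> / (\<delta> + m) * (a - b)\<^sup>2 \<le> (max 0 a - max 0 b) * (a - b)"
proof (cases "0 \<le> a")
  case True
  have "\<delta> / (\<delta> + m) * (a - b)\<^sup>2 \<le> 1 * (a - b)\<^sup>2"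
    using assms by (intro mult_right_mono) auto
  then show ?thesis using True assms by (simp add: power2_eq_square)
next
  case False
  have "\<delta> * (b - a) \<le> b * (\<delta> + m)"
  proof -
    have "\<delta> * (- a) \<le> b * m" using assms False by (intro mult_mono) auto
    then show ?thesis by (simp add: algebra_simps)
  qed
  then have "\<delta> / (\<delta> + m) * (b - a) \<le> b"
    using assms by (simp add: field_simps)
  then have "\<delta> / (\<delta> + m) * (b - a) * (b - a) \<le> b * (b - a)"
    using assms False by (intro mult_right_mono) auto
  moreover have "(a - b)\<^sup>2 = (b - a) * (b - a)" "b * (b - a) = (0 - b) * (a - b)"
    by (simp_all add: power2_eq_square algebra_simps)
  moreover have "max 0 a = 0" "max 0 b = b" using False assms by auto
  ultimately show ?thesis by (simp add: mult.assoc)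
qed

text \<open>The first order condition \<open>\<integral>(f\<^sub>* + g\<^sub>* - c)\<^sub>+ dQ = \<epsilon>\<close> turns a gradient step for \<open>(f, g)\<close> into a step
  for the error \<open>(f - f\<^sub>*, g - g\<^sub>*)\<close>, driven by the increment \<open>h\<close> of the excess.\<close>
lemma gd_step_descent:
  fixes P Q :: "'a::euclidean_space measure" and \<epsilon> \<eta> :: real
  assumes P: "prob_space P" "sets P = sets borel" and Q: "prob_space Q" "sets Q = sets borel"
    and \<eta>: "0 < \<eta>" "\<eta> < \<epsilon>"
    and f: "f \<in> borel_measurable P" "\<And>x. \<bar>f x\<bar> \<le> B" and g: "g \<in> borel_measurable Q" "\<And>x. \<bar>g x\<bar> \<le> B"
    and fs: "fs \<in> borel_measurable P" and gs: "gs \<in> borel_measurable Q"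
    and mp: "AE x in P. marginal_point \<epsilon> P Q fs gs x" "AE y in Q. marginal_point \<epsilon> Q P gs fs y"
    and f': "f' \<in> borel_measurable P" "\<And>x. x \<in> topological_support P \<Longrightarrow>
      f' x = f x + \<eta> * (1 - 1 / \<epsilon> * (\<integral>y. qot_excess f g x y \<partial>Q))"
    and g': "g' \<in> borel_measurable Q" "\<And>y. y \<in> topological_support Q \<Longrightarrow>
      g' y = g y + \<eta> * (1 - 1 / \<epsilon> * (\<integral>x. qot_excess f g x y \<partial>P))"
    and uv: "(\<lambda>x. f x - fs x, \<lambda>y. g y - gs y) \<in> L2sum P Q"
  defines "h \<equiv> \<lambda>z. qot_excess f g (fst z) (snd z) - qot_excess fs gs (fst z) (snd z)"
  shows "(\<lambda>x. f' x - fs x, \<lambda>y. g' y - gs y) \<in> L2sum P Q"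
    and "integrable (P \<Otimes>\<^sub>M Q) (\<lambda>z. h z * ((f (fst z) - fs (fst z)) + (g (snd z) - gs (snd z))))"
    and "(\<integral>x. (f' x - fs x)\<^sup>2 \<partial>P) + (\<integral>y. (g' y - gs y)\<^sup>2 \<partial>Q)
      \<le> (\<integral>x. (f x - fs x)\<^sup>2 \<partial>P) + (\<integral>y. (g y - gs y)\<^sup>2 \<partial>Q)
        - 2 * (\<eta> / \<epsilon>) * (1 - \<eta> / \<epsilon>) *
          (\<integral>z. h z * ((f (fst z) - fs (fst z)) + (g (snd z) - gs (snd z))) \<partial>(P \<Otimes>\<^sub>M Q))"
proof -
  interpret P: prob_space P by fact
  interpret Q: prob_space Q by fact
  have hm: "h \<in> borel_measurable (P \<Otimes>\<^sub>M Q)"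
    unfolding h_def by (intro borel_measurable_diff qot_excess_measurable P Q f g fs gs)
  have mono: "(h (x, y))\<^sup>2 \<le> h (x, y) * ((f x - fs x) + (g y - gs y))" for x y
    using pos_part_monotone[of "f x + g y - (norm (x - y))\<^sup>2 / 2" "fs x + gs y - (norm (x - y))\<^sup>2 / 2"]
    by (simp add: h_def qot_excess_def algebra_simps)
  note descent =
    gradient_step_descent(1)[OF P(1) Q(1) uv hm mono, where t = "\<eta> / \<epsilon>"]
    gradient_step_descent(2)[OF P(1) Q(1) uv hm mono]
    gradient_step_descent(3)[OF P(1) Q(1) uv hm mono, where t = "\<eta> / \<epsilon>"]
  have ae_f: "AE x in P. f' x - fs x = (f x - fs x) - \<eta> / \<epsilon> * (\<integral>y. h (x, y) \<partial>Q)"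
    using mp(1)
  proof eventually_elim
    case (elim x)
    then have x: "x \<in> topological_support P" "(\<integral>y. qot_excess fs gs x y \<partial>Q) = \<epsilon>"
      by (auto simp: marginal_point_def)
    have "integrable Q (qot_excess fs gs x)"
      using x(2) \<eta> not_integrable_integral_eq[of Q "qot_excess fs gs x"] by auto
    then have hI: "(\<integral>y. h (x, y) \<partial>Q) = (\<integral>y. qot_excess f g x y \<partial>Q) - \<epsilon>"
      unfolding h_def using qot_excess_integral(1)[OF Q g, of f x] x(2) by simp
    show ?case unfolding f'(2)[OF x(1)] hI using \<eta> by (simp add: field_simps)
  qed
  have ae_g: "AE y in Q. g' y - gs y = (g y - gs y) - \<eta> / \<epsilon> * (\<integral>x. h (x, y) \<partial>P)"
    using mp(2)
  proof eventually_elim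
    case (elim y)
    then have y: "y \<in> topological_support Q" "(\<integral>x. qot_excess gs fs y x \<partial>P) = \<epsilon>"
      by (auto simp: marginal_point_def)
    have swap: "qot_excess gs fs y = (\<lambda>x. qot_excess fs gs x y)" "qot_excess g f y = (\<lambda>x. qot_excess f g x y)"
      by (rule ext, rule qot_excess_swap)+
    have "integrable P (qot_excess gs fs y)"
      using y(2) \<eta> not_integrable_integral_eq[of P "qot_excess gs fs y"] by auto
    then have hI: "(\<integral>x. h (x, y) \<partial>P) = (\<integral>x. qot_excess f g x y \<partial>P) - \<epsilon>"
      unfolding h_def using qot_excess_integral(1)[OF P f, of g y] y(2) by (simp add: swap)
    show ?case unfolding g'(2)[OF y(1)] hI using \<eta> by (simp add: field_simps)
  qed
  note cong = L2sum_cong_AE[OF ae_f ae_g borel_measurable_diff[OF f'(1) fs] borel_measurable_diff[OF g'(1) gs] descent(1)]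
  show "(\<lambda>x. f' x - fs x, \<lambda>y. g' y - gs y) \<in> L2sum P Q" by (rule cong(1))
  show "integrable (P \<Otimes>\<^sub>M Q) (\<lambda>z. h z * ((f (fst z) - fs (fst z)) + (g (snd z) - gs (snd z))))"
    by (rule descent(2))
  show "(\<integral>x. (f' x - fs x)\<^sup>2 \<partial>P) + (\<integral>y. (g' y - gs y)\<^sup>2 \<partial>Q)
      \<le> (\<integral>x. (f x - fs x)\<^sup>2 \<partial>P) + (\<integral>y. (g y - gs y)\<^sup>2 \<partial>Q)
        - 2 * (\<eta> / \<epsilon>) * (1 - \<eta> / \<epsilon>) *
          (\<integral>z. h z * ((f (fst z) - fs (fst z)) + (g (snd z) - gs (snd z))) \<partial>(P \<Otimes>\<^sub>M Q))"
    unfolding cong(2,3) by (rule descent(3))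
qed

lemma geometric_decay:
  fixes N :: "nat \<Rightarrow> real"
  assumes q: "0 < q" "q < 1" and N: "\<And>n. 0 \<le> N n" "\<And>n. N (Suc n) \<le> q * N n"
  obtains \<delta> n0 where "0 < \<delta>" "\<delta> < 1" "\<And>n. n \<ge> n0 \<Longrightarrow> sqrt (N n) \<le> \<delta> ^ n"
proof -
  have Nq: "N n \<le> q ^ n * N 0" for n
  proof (induction n)
    case (Suc n)
    have "N (Suc n) \<le> q * N n" by (rule N(2))
    also have "\<dots> \<le> q * (q ^ n * N 0)" using Suc q by (intro mult_left_mono) auto
    finally show ?case by (simp add: mult.assoc)
  qed simp
  \<comment> \<open>Any rate with \<open>q < \<delta>\<^sup>2 < 1\<close> works: the surplus \<open>(q / \<delta>\<^sup>2)\<^sup>n\<close> absorbs the constant \<open>N 0\<close>.\<close>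
  define \<delta> where "\<delta> = sqrt ((1 + q) / 2)"
  have \<delta>: "0 < \<delta>" "\<delta> < 1" and \<delta>2: "\<delta>\<^sup>2 = (1 + q) / 2"
    using q by (auto simp: \<delta>_def)
  define c where "c = q / \<delta>\<^sup>2"
  have c: "0 \<le> c" "c < 1" using q by (auto simp: c_def \<delta>2 field_simps)
  have "(\<lambda>n. c ^ n * N 0) \<longlonglongrightarrow> 0"
    using c by (intro tendsto_mult_left_zero LIMSEQ_power_zero) auto
  then have "eventually (\<lambda>n. c ^ n * N 0 < 1) sequentially"
    by (rule order_tendstoD) simp
  then obtain n0 where n0: "\<And>n. n \<ge> n0 \<Longrightarrow> c ^ n * N 0 < 1"
    by (auto simp: eventually_sequentially)
  have "sqrt (N n) \<le> \<delta> ^ n" if "n \<ge> n0" for n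
  proof (rule real_le_lsqrt)
    have "q = c * \<delta>\<^sup>2" using \<delta>(1) by (simp add: c_def)
    then have "N n \<le> (c * \<delta>\<^sup>2) ^ n * N 0" using Nq[of n] by simp
    also have "\<dots> = (c ^ n * N 0) * (\<delta> ^ n)\<^sup>2"
      by (simp add: power_mult_distrib power_mult[symmetric] mult.commute)
    also have "\<dots> \<le> 1 * (\<delta> ^ n)\<^sup>2"
      using n0[OF that] by (intro mult_right_mono) auto
    finally show "N n \<le> (\<delta> ^ n)\<^sup>2" by simp
  qed (use N(1) \<delta>(1) in auto)
  with \<delta> show thesis by (rule that)
qed

theorem theorem2p3:
  fixes P Q :: "'a::euclidean_space measure"
    and \<epsilon> \<eta> :: real
    and f0 g0 fstar gstar :: "'a \<Rightarrow> real"
  assumes "\<epsilon> > 0"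
    and "prob_space P" and "sets P = sets borel"
    and "prob_space Q" and "sets Q = sets borel"
    and "charges_no_convex_boundary P" and "charges_no_convex_boundary Q"
    and "compact (topological_support P)" and "compact (topological_support Q)"
    and "connected (topological_support Q)"
    and "\<exists>L. L-lipschitz_on (topological_support P) f0"
    and "\<exists>L. L-lipschitz_on (topological_support Q) g0"
    and "(LINT x:topological_support P|P. f0 x) = (LINT y:topological_support Q|Q. g0 y)"
    and "0 < \<eta>" and "\<eta> < \<epsilon>"
    and "qot_potentials \<epsilon> P Q (fstar, gstar)"
  shows "\<exists>\<delta> n0. 0 < \<delta> \<and> \<delta> < 1 \<and>
    (\<forall>n\<ge>n0. L2sum_norm P Q (gd_iter \<epsilon> \<eta> P Q f0 g0 n - (fstar, gstar)) \<le> \<delta> ^ n)"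
proof -
  note \<epsilon> = assms(1) and P = assms(2,3) and Q = assms(4,5) and \<eta> = assms(14,15)
  interpret P: prob_space P by fact
  interpret Q: prob_space Q by fact
  interpret PQ: pair_prob_space P Q ..
  have pot: "(fstar, gstar) \<in> L2sum P Q"
    using assms(16) by (simp add: qot_potentials_def)
  then have fs2: "square_integrable P fstar" and gs2: "square_integrable Q gstar"
    and mean: "integral\<^sup>L P fstar = integral\<^sup>L Q gstar"
    by (auto simp: L2sum_def)
  then have fs[measurable]: "fstar \<in> borel_measurable P" and gs[measurable]: "gstar \<in> borel_measurable Q"
    by (auto simp: square_integrable_def)
  note mp = AE_marginal_point[OF \<epsilon> P Q assms(16)]
  obtain a b where "\<And>x. x \<in> topological_support P \<Longrightarrow> norm x \<le> a" "\<And>y. y \<in> topological_support Q \<Longrightarrow> norm y \<le> b"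
    using compact_imp_bounded[OF assms(8)] compact_imp_bounded[OF assms(9)] by (auto simp: bounded_iff)
  then have D: "norm (x - y) \<le> a + b" if "x \<in> topological_support P" "y \<in> topological_support Q" for x y
    using norm_triangle_ineq4[of x y] that by (smt (verit))
  define K where "K = (a + b)\<^sup>2 / 2"
  have K: "(norm (x - y))\<^sup>2 / 2 \<le> K" if "x \<in> topological_support P" "y \<in> topological_support Q" for x y
    using D[OF that] by (simp add: K_def power_mono)

  define F G where "F n = fst (gd_iter \<epsilon> \<eta> P Q f0 g0 n)" and "G n = snd (gd_iter \<epsilon> \<eta> P Q f0 g0 n)" for n
  have F0: "F 0 = (\<lambda>x. if x \<in> topological_support P then f0 x else 0)"
    and G0: "G 0 = (\<lambda>x. if x \<in> topological_support Q then g0 x else 0)"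
    by (simp_all add: F_def G_def)
  have F_Suc: "F (Suc n) x = F n x + \<eta> * (1 - 1 / \<epsilon> * (\<integral>y. qot_excess (F n) (G n) x y \<partial>Q))"
    if "x \<in> topological_support P" for n x
    using that by (simp add: F_def G_def case_prod_unfold Let_def)
  have G_Suc: "G (Suc n) y = G n y + \<eta> * (1 - 1 / \<epsilon> * (\<integral>x. qot_excess (F n) (G n) x y \<partial>P))"
    if "y \<in> topological_support Q" for n y
    using that by (simp add: F_def G_def case_prod_unfold Let_def)
  have cont: "continuous_on (topological_support P) f0" "continuous_on (topological_support Q) g0"
    using assms(11,12) lipschitz_on_continuous_on by blast+
  note reg = gd_iter_measurable_bounded[OF P Q assms(8,9) cont \<eta>, folded F_def G_def]
  have F[measurable]: "F n \<in> borel_measurable P" and G[measurable]: "G n \<in> borel_measurable Q" for n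
    using reg[of n] by auto

  define u v where "u n x = F n x - fstar x" and "v n y = G n y - gstar y" for n x y
  define h where "h n z = qot_excess (F n) (G n) (fst z) (snd z) - qot_excess fstar gstar (fst z) (snd z)" for n z
  define N where "N n = (\<integral>x. (u n x)\<^sup>2 \<partial>P) + (\<integral>y. (v n y)\<^sup>2 \<partial>Q)" for n
  define J where "J n = (\<integral>z. h n z * (u n (fst z) + v n (snd z)) \<partial>(P \<Otimes>\<^sub>M Q))" for n
  define t where "t = \<eta> / \<epsilon>"
  have t: "0 < t" "t < 1" using \<eta> by (auto simp: t_def)
  have step: "(u (Suc n), v (Suc n)) \<in> L2sum P Q"
    "integrable (P \<Otimes>\<^sub>M Q) (\<lambda>z. h n z * (u n (fst z) + v n (snd z)))"
    "N (Suc n) \<le> N n - 2 * t * (1 - t) * J n" if "(u n, v n) \<in> L2sum P Q" for n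
  proof -
    obtain B where B: "\<And>x. \<bar>F n x\<bar> \<le> B" "\<And>x. \<bar>G n x\<bar> \<le> B" using reg[of n] by blast
    note d = gd_step_descent[OF P Q \<eta> F B(1) G B(2) fs gs mp F F_Suc G G_Suc
        that[unfolded u_def[abs_def] v_def[abs_def]]]
    show "(u (Suc n), v (Suc n)) \<in> L2sum P Q"
      using d(1) unfolding u_def[abs_def] v_def[abs_def] by simp
    show "integrable (P \<Otimes>\<^sub>M Q) (\<lambda>z. h n z * (u n (fst z) + v n (snd z)))"
      using d(2) unfolding u_def v_def h_def by simp
    show "N (Suc n) \<le> N n - 2 * t * (1 - t) * J n"
      using d(3) unfolding N_def J_def u_def v_def h_def t_def by simp
  qed
  have uv: "(u n, v n) \<in> L2sum P Q" for n
  proof (induction n)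
    case 0
    obtain B where B: "\<And>x. \<bar>F 0 x\<bar> \<le> B" "\<And>x. \<bar>G 0 x\<bar> \<le> B" using reg[of 0] by blast
    have F2: "square_integrable P (F 0)" and G2: "square_integrable Q (G 0)"
      by (intro P.square_integrable_bounded[OF F B(1)] Q.square_integrable_bounded[OF G B(2)])+
    have "F 0 = (\<lambda>x. indicator (topological_support P) x *\<^sub>R f0 x)"
      "G 0 = (\<lambda>y. indicator (topological_support Q) y *\<^sub>R g0 y)"
      by (auto simp: F0 G0)
    then have "integral\<^sup>L P (F 0) = integral\<^sup>L Q (G 0)"
      using assms(13) unfolding set_lebesgue_integral_def by simp
    then show ?case
      using F2 G2 fs2 gs2 mean
      by (auto simp: L2sum_def u_def[abs_def] v_def[abs_def] intro!: square_integrable_diff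
          simp: P.square_integrable_integrable Q.square_integrable_integrable)
  next
    case (Suc n) then show ?case by (rule step(1))
  qed
  have hD: "0 \<le> h n z * (u n (fst z) + v n (snd z))" for n z
    using order_trans[OF zero_le_power2 pos_part_monotone[of
      "F n (fst z) + G n (snd z) - (norm (fst z - snd z))\<^sup>2 / 2"
      "fstar (fst z) + gstar (snd z) - (norm (fst z - snd z))\<^sup>2 / 2"]]
    by (simp add: h_def qot_excess_def u_def v_def algebra_simps)
  have J0: "0 \<le> J n" for n
    unfolding J_def by (rule Bochner_Integration.integral_nonneg[OF hD])
  have N0: "0 \<le> N n" for n
    by (simp add: N_def)
  have N_le: "N n \<le> N 0" for n
  proof (induction n)
    case (Suc n)
    have "0 \<le> 2 * t * (1 - t) * J n" using t J0 by simp
    then show ?case using step(3)[OF uv, of n] Suc by linarith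
  qed simp

  \<comment> \<open>The errors are bounded in \<open>L\<^sup>2\<close>, so the means of the iterates are bounded below. This lower
    bound starts the pointwise estimates.\<close>
  define m where "m = integral\<^sup>L P fstar - sqrt (N 0)"
  have mean_le: "m \<le> integral\<^sup>L P (F n)" "m \<le> integral\<^sup>L Q (G n)" for n
  proof -
    have u: "square_integrable P (u n)" and v: "square_integrable Q (v n)"
      using uv[of n] by (auto simp: L2sum_def)
    have "(- integral\<^sup>L P (u n))\<^sup>2 \<le> N n" "(- integral\<^sup>L Q (v n))\<^sup>2 \<le> N n"
      using P.expectation_square_le[OF u] Q.expectation_square_le[OF v] unfolding N_def
      by (simp_all add: add_increasing add_increasing2)
    then have "- integral\<^sup>L P (u n) \<le> sqrt (N 0)" "- integral\<^sup>L Q (v n) \<le> sqrt (N 0)"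
      using N_le[of n] by (intro real_le_rsqrt; linarith)+
    moreover have "integral\<^sup>L P (\<lambda>x. u n x + fstar x) = integral\<^sup>L P (u n) + integral\<^sup>L P fstar"
      "integral\<^sup>L Q (\<lambda>x. v n x + gstar x) = integral\<^sup>L Q (v n) + integral\<^sup>L Q gstar"
      by (intro Bochner_Integration.integral_add P.square_integrable_integrable
          Q.square_integrable_integrable u v fs2 gs2)+
    ultimately show "m \<le> integral\<^sup>L P (F n)" "m \<le> integral\<^sup>L Q (G n)"
      using mean by (simp_all add: m_def u_def v_def)
  qed
  obtain B0 where B0: "\<And>x. \<bar>F 0 x\<bar> \<le> B0" "\<And>x. \<bar>G 0 x\<bar> \<le> B0" using reg[of 0] by blast
  \<comment> \<open>One constant bounds both iterates from above and from below: the upper bound on one of them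
    is the lower bound, up to the sign, on the other.\<close>
  define U where "U = max B0 (\<epsilon> + K - m)"
  have U: "B0 \<le> U" "\<epsilon> + K - m \<le> U" by (auto simp: U_def)
  have suppP: "AE x in P. x \<in> topological_support P" and suppQ: "AE y in Q. y \<in> topological_support Q"
    by (intro AE_topological_support P Q)+
  have bounded: "(\<forall>x\<in>topological_support P. F n x \<le> U \<and> - U \<le> F n x) \<and>
    (\<forall>y\<in>topological_support Q. G n y \<le> U \<and> - U \<le> G n y)" for n
  proof (induction n)
    case 0
    have "F 0 x \<le> U \<and> - U \<le> F 0 x" "G 0 x \<le> U \<and> - U \<le> G 0 x" for x
      using B0[of x] U(1) by linarith+
    then show ?case by blast
  next
    case (Suc n)
    obtain B where B: "\<And>x. \<bar>F n x\<bar> \<le> B" "\<And>x. \<bar>G n x\<bar> \<le> B" using reg[of n] by blast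
    have "F (Suc n) x \<le> U \<and> - U \<le> F (Suc n) x" if x: "x \<in> topological_support P" for x
      unfolding F_Suc[OF x]
    proof
      show "F n x + \<eta> * (1 - 1 / \<epsilon> * (\<integral>y. qot_excess (F n) (G n) x y \<partial>Q)) \<le> U"
      proof (rule gd_step_le[OF Q G B(2) _ mean_le(2) \<eta> _ U(2)])
        show "AE y in Q. (norm (x - y))\<^sup>2 / 2 \<le> K"
          using suppQ by eventually_elim (rule K[OF x])
      qed (use Suc x in auto)
      show "- U \<le> F n x + \<eta> * (1 - 1 / \<epsilon> * (\<integral>y. qot_excess (F n) (G n) x y \<partial>Q))"
        using suppQ Suc x by (intro gd_step_ge[OF Q G B(2) _ _ \<eta>]) (auto elim!: eventually_mono)
    qed
    moreover have "G (Suc n) y \<le> U \<and> - U \<le> G (Suc n) y" if y: "y \<in> topological_support Q" for y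
      unfolding G_Suc[OF y] qot_excess_swap[of "F n" "G n"]
    proof
      show "G n y + \<eta> * (1 - 1 / \<epsilon> * (\<integral>x. qot_excess (G n) (F n) y x \<partial>P)) \<le> U"
      proof (rule gd_step_le[OF P F B(1) _ mean_le(1) \<eta> _ U(2)])
        show "AE x in P. (norm (y - x))\<^sup>2 / 2 \<le> K"
          using suppP unfolding norm_minus_commute[of y] by eventually_elim (rule K[OF _ y])
      qed (use Suc y in auto)
      show "- U \<le> G n y + \<eta> * (1 - 1 / \<epsilon> * (\<integral>x. qot_excess (G n) (F n) y x \<partial>P))"
        using suppP Suc y by (intro gd_step_ge[OF P F B(1) _ _ \<eta>]) (auto elim!: eventually_mono)
    qed
    ultimately show ?case by blast
  qed

  define z where "z p = fstar (fst p) + gstar (snd p) - (norm (fst p - snd p))\<^sup>2 / 2" for p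
  define S where "S = {p \<in> space (P \<Otimes>\<^sub>M Q). \<epsilon> / 2 \<le> z p}"
  note [measurable_cong] = P(2) Q(2)
  have S[measurable]: "S \<in> sets (P \<Otimes>\<^sub>M Q)"
    unfolding S_def z_def by measurable
  note mpPQ = PQ.AE_pair_fst[OF mp(1)] PQ.AE_pair_snd[OF mp(2)]
  have boxX: "\<exists>y\<in>topological_support Q. \<exists>r>0. AE p in P \<Otimes>\<^sub>M Q. p \<in> ball x r \<times> ball y r \<longrightarrow> p \<in> S"
    if x: "x \<in> topological_support P" for x
  proof -
    obtain y r where y: "y \<in> topological_support Q" "0 < r"
      and box: "\<And>x1 y1. \<lbrakk>x1 \<in> ball x r; y1 \<in> ball y r; marginal_point \<epsilon> P Q fstar gstar x1;
        marginal_point \<epsilon> Q P gstar fstar y1\<rbrakk> \<Longrightarrow> \<epsilon> / 2 \<le> fstar x1 + gstar y1 - (norm (x1 - y1))\<^sup>2 / 2"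
      using positive_excess_box[OF \<epsilon> P Q fs gs D mp x] by blast
    have "AE p in P \<Otimes>\<^sub>M Q. p \<in> ball x r \<times> ball y r \<longrightarrow> p \<in> S"
      using mpPQ AE_space
    proof eventually_elim
      case (elim p)
      then show ?case
        using box[of "fst p" "snd p"] by (auto simp: S_def z_def mem_Times_iff simp del: mem_ball)
    qed
    then show ?thesis using y by blast
  qed
  have boxY: "\<exists>x\<in>topological_support P. \<exists>r>0. AE p in P \<Otimes>\<^sub>M Q. p \<in> ball x r \<times> ball y r \<longrightarrow> p \<in> S"
    if y: "y \<in> topological_support Q" for y
  proof -
    have D': "norm (y - x) \<le> a + b" if "y \<in> topological_support Q" "x \<in> topological_support P" for x y
      using D[OF that(2,1)] by (simp add: norm_minus_commute)
    obtain x r where x: "x \<in> topological_support P" "0 < r"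
      and box: "\<And>y1 x1. \<lbrakk>y1 \<in> ball y r; x1 \<in> ball x r; marginal_point \<epsilon> Q P gstar fstar y1;
        marginal_point \<epsilon> P Q fstar gstar x1\<rbrakk> \<Longrightarrow> \<epsilon> / 2 \<le> gstar y1 + fstar x1 - (norm (y1 - x1))\<^sup>2 / 2"
      using positive_excess_box[OF \<epsilon> Q P gs fs D' mp(2,1) y] by blast
    have "AE p in P \<Otimes>\<^sub>M Q. p \<in> ball x r \<times> ball y r \<longrightarrow> p \<in> S"
      using mpPQ AE_space
    proof eventually_elim
      case (elim p)
      then show ?case
        using box[of "snd p" "fst p"]
        by (auto simp: S_def z_def mem_Times_iff norm_minus_commute add.commute simp del: mem_ball)
    qed
    then show ?thesis using x by blast
  qed
  obtain \<kappa> where \<kappa>: "0 < \<kappa>"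
    and gap: "\<And>u v. (u, v) \<in> L2sum P Q \<Longrightarrow> \<kappa> * ((\<integral>x. (u x)\<^sup>2 \<partial>P) + (\<integral>y. (v y)\<^sup>2 \<partial>Q))
      \<le> (\<integral>p. indicator S p * (u (fst p) + v (snd p))\<^sup>2 \<partial>(P \<Otimes>\<^sub>M Q))"
    using spectral_gap[OF P assms(8) Q assms(9,10) S boxX boxY] by blast

  \<comment> \<open>The modulus of \<open>pos_part_strongly_monotone\<close> with \<open>\<delta> = \<epsilon>/2\<close>, as on \<open>S\<close>, and \<open>m = 2U + K\<close>;
    on the supports \<open>f\<^sub>n + g\<^sub>n - c\<close> is at least \<open>-m\<close>.\<close>
  define \<alpha> where "\<alpha> = \<epsilon> / 2 / (\<epsilon> / 2 + (2 * U + K))"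
  have U0: "0 \<le> 2 * U + K"
    using B0(1)[of undefined] U(1) by (auto simp: K_def intro!: add_nonneg_nonneg)
  have \<alpha>: "0 < \<alpha>" using \<epsilon> U0 by (simp add: \<alpha>_def)
  have J_ge: "\<alpha> * \<kappa> * N n \<le> J n" for n
  proof -
    have u: "square_integrable P (u n)" and v: "square_integrable Q (v n)"
      using uv[of n] by (auto simp: L2sum_def)
    have "square_integrable (P \<Otimes>\<^sub>M Q) (\<lambda>p. u n (fst p) + v n (snd p))"
      by (intro square_integrable_add PQ.square_integrable_comp_fst PQ.square_integrable_comp_snd u v)
    then have "integrable (P \<Otimes>\<^sub>M Q) (\<lambda>p. (u n (fst p) + v n (snd p))\<^sup>2)"
      by (simp add: square_integrable_def)
    from integrable_mult_indicator[OF S this]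
    have int: "integrable (P \<Otimes>\<^sub>M Q) (\<lambda>p. \<alpha> * (indicator S p * (u n (fst p) + v n (snd p))\<^sup>2))"
      by simp
    have "\<alpha> * (\<kappa> * N n) \<le> \<alpha> * (\<integral>p. indicator S p * (u n (fst p) + v n (snd p))\<^sup>2 \<partial>(P \<Otimes>\<^sub>M Q))"
      using gap[OF uv[of n]] \<alpha> unfolding N_def by (intro mult_left_mono) auto
    also have "\<dots> = (\<integral>p. \<alpha> * (indicator S p * (u n (fst p) + v n (snd p))\<^sup>2) \<partial>(P \<Otimes>\<^sub>M Q))"
      by simp
    also have "\<dots> \<le> J n" unfolding J_def
    proof (rule integral_mono_AE[OF int step(2)[OF uv]])
      show "AE p in P \<Otimes>\<^sub>M Q. \<alpha> * (indicator S p * (u n (fst p) + v n (snd p))\<^sup>2)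
        \<le> h n p * (u n (fst p) + v n (snd p))"
        using PQ.AE_pair_fst[OF suppP] PQ.AE_pair_snd[OF suppQ]
      proof eventually_elim
        case (elim p)
        show ?case
        proof (cases "p \<in> S")
          case True
          define w where "w = F n (fst p) + G n (snd p) - (norm (fst p - snd p))\<^sup>2 / 2"
          have "- (2 * U + K) \<le> w"
            using bounded[of n] elim K[OF elim] unfolding w_def by (smt (verit))
          from pos_part_strongly_monotone[OF _ _ U0 this, of "\<epsilon> / 2" "z p"] True \<epsilon>
          have "\<alpha> * (w - z p)\<^sup>2 \<le> (max 0 w - max 0 (z p)) * (w - z p)"
            by (simp add: S_def \<alpha>_def)
          moreover have "w - z p = u n (fst p) + v n (snd p)" "max 0 w - max 0 (z p) = h n p"
            by (simp_all add: w_def z_def u_def v_def h_def qot_excess_def)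
          ultimately show ?thesis using True by simp
        next
          case False then show ?thesis using hD by simp
        qed
      qed
    qed
    finally show ?thesis by (simp add: mult.assoc)
  qed
  define c where "c = 2 * t * (1 - t) * (\<alpha> * \<kappa>)"
  have c: "0 < c" using t \<alpha> \<kappa> by (simp add: c_def)
  \<comment> \<open>The maximum keeps the rate positive.\<close>
  have N_step: "N (Suc n) \<le> max (1 / 2) (1 - c) * N n" for n
  proof -
    have "2 * t * (1 - t) * (\<alpha> * \<kappa> * N n) \<le> 2 * t * (1 - t) * J n"
      using t J_ge by (intro mult_left_mono) auto
    then have "N (Suc n) \<le> (1 - c) * N n"
      using step(3)[OF uv, of n] by (simp add: c_def algebra_simps)
    also have "\<dots> \<le> max (1 / 2) (1 - c) * N n"
      using N0 by (intro mult_right_mono) auto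
    finally show ?thesis .
  qed
  have "0 < max (1 / 2) (1 - c)" "max (1 / 2) (1 - c) < 1"
    using c by (simp_all add: less_max_iff_disj)
  then obtain \<delta> n0 where "0 < \<delta>" "\<delta> < 1" "\<And>n. n \<ge> n0 \<Longrightarrow> sqrt (N n) \<le> \<delta> ^ n"
    using geometric_decay[of "max (1 / 2) (1 - c)" N] N0 N_step by blast
  moreover have "L2sum_norm P Q (gd_iter \<epsilon> \<eta> P Q f0 g0 n - (fstar, gstar)) = sqrt (N n)" for n
    by (simp add: L2sum_norm_def L2sum_inner_def N_def u_def v_def F_def G_def power2_eq_square)
  ultimately show ?thesis by auto
qed

end
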